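(* Consider an electrical circuit, modeled as described in the context, in which the elastance $E_m$ of $q$-memristors and the reluctance $\mathcal{R}_w$ of $\varphi$-memristors vanish at equilibria. Suppose that at a given equilibrium the resistance and conductance matrices $R$, $G$ are positive definite and the elastance $E_c$ of capacitors and the reluctance $\mathcal{R}_l$ of inductors are non-singular. Then the geometric multiplicity of the null eigenvalue (of the linearization at that equilibrium) equals the number of memristors ($q$- and $\varphi$-memristors) plus the number of independent VL-loops plus the number of independent IC-cutsets.
   Context: Circuit setting. The circuit has an underlying digraph $\mathcal{G}$ with $n$ nodes, $m$ branches and $k$ connected components. A cutset is a set of branches whose removal increases the number of connected components and which is minimal with this property; a loop is a cycle of branches. Let $B$ be a reduced loop matrix (full-row-rank set of rows of the loop matrix, entries $1,-1,0$ according as a branch is in a loop with the same orientation, opposite orientation, or not at all) and $D$ a reduced cutset matrix (analogous with oriented cutsets), with columns in the same branch order. For a set of branches $K$, $B_K$, $D_K$ are the submatrices of columns of branches in $K$; the number of independent cutsets formed only by branches of $K$ is $\dim\ker B_K$, and the number of independent loops formed only by branches of $K$ is $\dim\ker D_K$. Each branch carries a voltage $v$ and current $i$ and belongs to one of eight classes. $q$-devices ($v=\eta(q,i,t)$, $C^1$): $q$-memristors $v_m=\eta_1(q_m,i_m,t)$ (with $\partial\eta_1/\partial q_m\not\equiv0$, $\partial\eta_1/\partial i_m\not\equiv0$), capacitors $v_c=\eta_2(q_c,t)$, current-controlled resistors $v_r=\eta_3(i_r,t)$, voltage sources $v_u=\eta_4(t)$. $\varphi$-devices ($i=\zeta(\varphi,v,t)$,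 $C^1$): $\varphi$-memristors $i_w=\zeta_1(\varphi_w,v_w,t)$ (with $\partial\zeta_1/\partial\varphi_w\not\equiv0$, $\partial\zeta_1/\partial v_w\not\equiv0$), inductors $i_l=\zeta_2(\varphi_l,t)$, voltage-controlled resistors $i_g=\zeta_3(v_g,t)$, current sources $i_j=\zeta_4(t)$. Maps may be vector-valued. With $B=(B_q\ B_\varphi)$, $D=(D_q\ D_\varphi)$ split by $q$- and $\varphi$-devices, and $q_{mc}=(q_m,q_c)$, $\varphi_{wl}=(\varphi_w,\varphi_l)$, the circuit is modeled by the semiexplicit differential-algebraic system $q_{mc}'=i_{mc}$, $\varphi_{wl}'=v_{wl}$, $0=v_q-f(q_{mc},i_q,t)$, $0=i_\varphi-g(\varphi_{wl},v_\varphi,t)$, $0=B_qv_q+B_\varphi v_\varphi$, $0=D_qi_q+D_\varphi i_\varphi$, where $f$ collects $\eta_1,\dots,\eta_4$ and $g$ collects $\zeta_1,\dots,\zeta_4$. An equilibrium point is a point at which all right-hand sides vanish. The linearization at an equilibrium is the matrix pencil $\lambda H-K$, where $K$ is the Jacobian of the right-hand sides with respect to $(q_{mc},\varphi_{wl},v_q,i_q,v_\varphi,i_\varphi)$ at the equilibrium and $H=\mathrm{block\text{-}diag}\{I,0\}$ (identity on the differential variables $q_{mc},\varphi_{wl}$); the geometric multiplicity of the null eigenvalue is $\dim\ker K$. Characteristic matrices: resistance $R=\partial\eta_3/\partial i_r$, conductance $G=\partial\zeta_3/\partial v_g$, elastances $E_m=\partial\eta_1/\partial q_m$, $E_c=\partial\eta_2/\partial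 q_c$, reluctances $\mathcal{R}_w=\partial\zeta_1/\partial\varphi_w$, $\mathcal{R}_l=\partial\zeta_2/\partial\varphi_l$. A square matrix $P$ is positive definite if $u^TPu>0$ for all $u\ne0$ (symmetry not assumed). A VL-loop is a loop consisting only of voltage sources and/or inductors; an IC-cutset is a cutset consisting only of current sources and/or capacitors. *)

theory Defs
  imports "Jordan_Normal_Form.Matrix_Kernel" "Jordan_Normal_Form.DL_Rank"
          "Jordan_Normal_Form.DL_Submatrix"
begin

definition digraph_ok :: "nat \<Rightarrow> nat \<Rightarrow> (nat \<Rightarrow> nat) \<Rightarrow> (nat \<Rightarrow> nat) \<Rightarrow> bool" where
  "digraph_ok n m src dst \<longleftrightarrow> (\<forall>b<m. src b < n \<and> dst b < n)"

text \<open>An oriented loop (simple cycle of branches) and its row of the loop matrix: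
  branches es!j traversed with orientation ds!j (True = same as branch orientation)
  through the pairwise distinct nodes vs!j.\<close>

definition loop_vec :: "nat \<Rightarrow> nat \<Rightarrow> (nat \<Rightarrow> nat) \<Rightarrow> (nat \<Rightarrow> nat) \<Rightarrow> real vec \<Rightarrow> bool" where
  "loop_vec n m src dst x \<longleftrightarrow>
     (\<exists>es ds vs. 0 < length es \<and> length ds = length es \<and> length vs = length es \<and>
        distinct es \<and> distinct vs \<and> set es \<subseteq> {..<m} \<and>
        (\<forall>j<length es.
           (ds!j \<and> src (es!j) = vs!j \<and> dst (es!j) = vs!((j+1) mod length es)) \<or>
           (\<not> ds!j \<and> dst (es!j) = vs!j \<and> src (es!j) = vs!((j+1) mod length es))) \<and>
        x = vec m (\<lambda>b. \<Sum>j<length es. if es!j = b then (if ds!j then 1 else -1) else 0))"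

definition conn :: "(nat \<Rightarrow> nat) \<Rightarrow> (nat \<Rightarrow> nat) \<Rightarrow> nat set \<Rightarrow> nat \<Rightarrow> nat \<Rightarrow> bool" where
  "conn src dst E u v \<longleftrightarrow>
     (u, v) \<in> {(a, c). \<exists>e\<in>E. (src e = a \<and> dst e = c) \<or> (dst e = a \<and> src e = c)}\<^sup>*"

definition ncomp :: "nat \<Rightarrow> (nat \<Rightarrow> nat) \<Rightarrow> (nat \<Rightarrow> nat) \<Rightarrow> nat set \<Rightarrow> nat" where
  "ncomp n src dst E = card ((\<lambda>v. {w. w < n \<and> conn src dst E v w}) ` {..<n})"

definition is_cutset :: "nat \<Rightarrow> nat \<Rightarrow> (nat \<Rightarrow> nat) \<Rightarrow> (nat \<Rightarrow> nat) \<Rightarrow> nat set \<Rightarrow> bool" where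
  "is_cutset n m src dst C \<longleftrightarrow> C \<subseteq> {..<m} \<and>
     ncomp n src dst ({..<m} - C) > ncomp n src dst {..<m} \<and>
     (\<forall>C'. C' \<subset> C \<longrightarrow> \<not> ncomp n src dst ({..<m} - C') > ncomp n src dst {..<m})"

text \<open>Row of the cutset matrix of an oriented cutset: the cutset C separates the node set
  S (a component of the graph with C removed) from the rest; branches leaving S get +1,
  branches entering S get -1.\<close>

definition cutset_vec :: "nat \<Rightarrow> nat \<Rightarrow> (nat \<Rightarrow> nat) \<Rightarrow> (nat \<Rightarrow> nat) \<Rightarrow> real vec \<Rightarrow> bool" where
  "cutset_vec n m src dst x \<longleftrightarrow>
     (\<exists>C v. is_cutset n m src dst C \<and> v < n \<and>
        (let S = {w. w < n \<and> conn src dst ({..<m} - C) v w} in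
          C = {e. e < m \<and> (src e \<in> S) \<noteq> (dst e \<in> S)} \<and>
          x = vec m (\<lambda>e. if src e \<in> S \<and> dst e \<notin> S then 1
                         else if dst e \<in> S \<and> src e \<notin> S then -1 else 0)))"

definition reduced_loop_matrix :: "nat \<Rightarrow> nat \<Rightarrow> (nat \<Rightarrow> nat) \<Rightarrow> (nat \<Rightarrow> nat) \<Rightarrow> real mat \<Rightarrow> bool" where
  "reduced_loop_matrix n m src dst B \<longleftrightarrow> dim_col B = m \<and>
     (\<forall>k < dim_row B. loop_vec n m src dst (row B k)) \<and>
     vec_space.rank (dim_row B) B = dim_row B \<and>
     (\<forall>x. loop_vec n m src dst x \<longrightarrow> (\<exists>y \<in> carrier_vec (dim_row B). x = transpose_mat B *\<^sub>v y))"

definition reduced_cutset_matrix :: "nat \<Rightarrow> nat \<Rightarrow> (nat \<Rightarrow> nat) \<Rightarrow> (nat \<Rightarrow> nat) \<Rightarrow> real mat \<Rightarrow> bool" where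
  "reduced_cutset_matrix n m src dst D \<longleftrightarrow> dim_col D = m \<and>
     (\<forall>k < dim_row D. cutset_vec n m src dst (row D k)) \<and>
     vec_space.rank (dim_row D) D = dim_row D \<and>
     (\<forall>x. cutset_vec n m src dst x \<longrightarrow> (\<exists>y \<in> carrier_vec (dim_row D). x = transpose_mat D *\<^sub>v y))"

datatype dev = QMem | Cap | CRes | VSrc | PhiMem | Ind | VRes | ISrc

definition qdev :: "dev \<Rightarrow> bool" where
  "qdev c \<longleftrightarrow> c \<in> {QMem, Cap, CRes, VSrc}"

text \<open>Branches carrying a differential variable (q for q-memristors and capacitors,
  phi for phi-memristors and inductors), in increasing branch order.\<close>

definition dyn_branches :: "nat \<Rightarrow> (nat \<Rightarrow> dev) \<Rightarrow> nat list" where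
  "dyn_branches m cls = filter (\<lambda>b. cls b \<in> {QMem, Cap, PhiMem, Ind}) [0..<m]"

definition ncls :: "nat \<Rightarrow> (nat \<Rightarrow> dev) \<Rightarrow> dev \<Rightarrow> nat" where
  "ncls m cls c = card {b. b < m \<and> cls b = c}"

definition cpos :: "(nat \<Rightarrow> dev) \<Rightarrow> nat \<Rightarrow> nat" where
  "cpos cls b = card {b'. b' < b \<and> cls b' = cls b}"

definition branches_of :: "nat \<Rightarrow> (nat \<Rightarrow> dev) \<Rightarrow> dev set \<Rightarrow> nat set" where
  "branches_of m cls S = {b. b < m \<and> cls b \<in> S}"

text \<open>Jacobian K of the right-hand sides at the equilibrium.
  Columns: 0..<p the differential variables (q or phi of the branches dyn_branches, in
  order), p+b the voltage of branch b, p+m+b the current of branch b.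
  Rows: 0..<p the equations q' = i, phi' = v; p+b the device equation of branch b;
  then the rows of B v = 0 and of D i = 0.
  Class matrices (indexed by position within the class):
  Em = d eta1/d q_m, Mq = d eta1/d i_m, Ec = d eta2/d q_c, R = d eta3/d i_r,
  Rw = d zeta1/d phi_w, Mw = d zeta1/d v_w, Rl = d zeta2/d phi_l, G = d zeta3/d v_g.\<close>

definition jac :: "nat \<Rightarrow> (nat \<Rightarrow> dev) \<Rightarrow> real mat \<Rightarrow> real mat \<Rightarrow>
    real mat \<Rightarrow> real mat \<Rightarrow> real mat \<Rightarrow> real mat \<Rightarrow>
    real mat \<Rightarrow> real mat \<Rightarrow> real mat \<Rightarrow> real mat \<Rightarrow> real mat" where
  "jac m cls B D Em Mq Ec R Rw Mw Rl G =
    (let ds = dyn_branches m cls; p = length ds; r = dim_row B; s = dim_row D;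
         blk = (\<lambda>c M b b'. if cls b = c \<and> cls b' = c then M $$ (cpos cls b, cpos cls b') else 0);
         dq = (\<lambda>b b'. blk QMem Em b b' + blk Cap Ec b b');
         di = (\<lambda>b b'. blk QMem Mq b b' + blk CRes R b b');
         dphi = (\<lambda>b b'. blk PhiMem Rw b b' + blk Ind Rl b b');
         dv = (\<lambda>b b'. blk PhiMem Mw b b' + blk VRes G b b')
     in mat (p + m + r + s) (p + 2 * m) (\<lambda>(row, col).
       if row < p then
         (let b = ds ! row in
           if qdev (cls b) then (if col = p + m + b then 1 else 0)
           else (if col = p + b then 1 else 0))
       else if row < p + m then
         (let b = row - p in
           if qdev (cls b) then
             (if col < p then - dq b (ds ! col)
              else if col < p + m then (if col - p = b then 1 else 0)
              else - di b (col - p - m))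
           else
             (if col < p then - dphi b (ds ! col)
              else if col < p + m then - dv b (col - p)
              else (if col - p - m = b then 1 else 0)))
       else if row < p + m + r then
         (if p \<le> col \<and> col < p + m then B $$ (row - p - m, col - p) else 0)
       else
         (if p + m \<le> col then D $$ (row - p - m - r, col - p - m) else 0)))"

text \<open>Positive definiteness without symmetry: u^T P u > 0 for all u \<noteq> 0.\<close>

definition pos_def_mat :: "real mat \<Rightarrow> bool" where
  "pos_def_mat P \<longleftrightarrow> square_mat P \<and>
     (\<forall>u \<in> carrier_vec (dim_row P). u \<noteq> 0\<^sub>v (dim_row P) \<longrightarrow> u \<bullet> (P *\<^sub>v u) > 0)"

end

theory Submission
  imports Defs
begin

text \<open>
  A kernel vector of the Jacobian consists of charges and fluxes \<open>x\<close>, voltages \<open>v\<close> and currents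
  \<open>i\<close> with \<open>B v = 0\<close> and \<open>D i = 0\<close>. Tellegen's theorem gives \<open>v \<bullet> i = 0\<close>. The device equations
  annihilate every term of this sum except the quadratic forms of \<open>R\<close> and \<open>G\<close>, so positive
  definiteness kills voltages and currents of all resistors. What survives is \<open>v\<close> on current
  sources and capacitors, subject to \<open>B v = 0\<close>, and \<open>i\<close> on voltage sources and inductors, subject to
  \<open>D i = 0\<close>. The component of \<open>x\<close> on capacitors and inductors is then determined since
  \<open>Ec\<close> and \<open>Rl\<close> are non-singular, and its component on memristors is free.

  Tellegen's theorem is derived from a minimal set \<open>T\<close> of branches connecting whatever the whole
  graph connects: subtracting from \<open>v\<close> the combination of fundamental cutsets that agrees with \<open>v\<close>
  on \<open>T\<close> leaves a vector vanishing on \<open>T\<close> and orthogonal to all loops, and the fundamental loops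
  show that it is zero. Hence \<open>v\<close> is a combination of cutset vectors.
\<close>

subsection \<open>Connectivity, loops and cutsets\<close>

lemma conn_refl: "conn src dst E u u"
  by (simp add: conn_def)

lemma conn_trans: "conn src dst E u v \<Longrightarrow> conn src dst E v w \<Longrightarrow> conn src dst E u w"
  unfolding conn_def by (rule rtrancl_trans)

lemma conn_edge: "e \<in> E \<Longrightarrow> conn src dst E (src e) (dst e)"
  unfolding conn_def by (rule r_into_rtrancl) auto

lemma conn_induct [consumes 1, case_names refl forward backward]:
  assumes "conn src dst E u v" and "P u"
    and "\<And>e. e \<in> E \<Longrightarrow> conn src dst E u (src e) \<Longrightarrow> P (src e) \<Longrightarrow> P (dst e)"
    and "\<And>e. e \<in> E \<Longrightarrow> conn src dst E u (dst e) \<Longrightarrow> P (dst e) \<Longrightarrow> P (src e)"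
  shows "P v"
  using assms(1) unfolding conn_def
proof (induction rule: rtrancl_induct)
  case base
  show ?case by (rule assms(2))
next
  case (step y z)
  then obtain e where e: "e \<in> E" "(src e = y \<and> dst e = z) \<or> (dst e = y \<and> src e = z)"
    by auto
  have "conn src dst E u y" using step(1) by (simp add: conn_def)
  then show ?case using e step(3) assms(3)[of e] assms(4)[of e] by auto
qed

lemma conn_sym:
  assumes "conn src dst E u v"
  shows "conn src dst E v u"
proof -
  have sym: "sym {(a, c). \<exists>e\<in>E. (src e = a \<and> dst e = c) \<or> (dst e = a \<and> src e = c)}"
    unfolding sym_def by auto
  show ?thesis using assms unfolding conn_def by (rule symD[OF sym_rtrancl[OF sym]])
qed

text \<open>Each branch of \<open>E\<close> along a path can be replaced by a path in
  \<open>F\<close>. This is how connectivity passes to a spanning subset and back.\<close>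

lemma conn_overlay:
  assumes uv: "conn src dst E u v"
    and E: "\<And>e. e \<in> E \<Longrightarrow> conn src dst F (src e) (dst e)"
  shows "conn src dst F u v"
  using uv
proof (induction rule: conn_induct)
  case refl show ?case by (rule conn_refl)
next
  case (forward e) then show ?case using E conn_trans by metis
next
  case (backward e) then show ?case using E conn_trans conn_sym by metis
qed

lemma conn_mono: "conn src dst E u v \<Longrightarrow> E \<subseteq> F \<Longrightarrow> conn src dst F u v"
  using conn_overlay[of src dst E u v F] conn_edge[of _ F src dst] by blast

lemma conn_closed:
  assumes "conn src dst E u v" and "\<And>e. e \<in> E \<Longrightarrow> src e \<in> S \<longleftrightarrow> dst e \<in> S"
  shows "u \<in> S \<longleftrightarrow> v \<in> S"
  using assms(1)
proof (induction rule: conn_induct)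
  case refl show ?case by simp
next
  case (forward e) then show ?case using assms(2)[of e] by simp
next
  case (backward e) then show ?case using assms(2)[of e] by simp
qed

text \<open>A path that uses \<open>t\<close> can be shortened to use it only once: it reaches one
  end of \<open>t\<close> inside \<open>E\<close> and goes on from the other. In the induction, a
  further passage through \<open>t\<close> returns to an end already reached inside
  \<open>E\<close>, or is the first passage.\<close>

lemma conn_insert_cases:
  assumes "conn src dst (insert t E) x y"
  shows "conn src dst E x y \<or> (conn src dst E x (src t) \<and> conn src dst E (dst t) y)
    \<or> (conn src dst E x (dst t) \<and> conn src dst E (src t) y)"
  using assms
proof (induction rule: conn_induct)
  case refl show ?case by (simp add: conn_refl)
next
  case (forward e)
  show ?case
  proof (cases "e = t")
    case True then show ?thesis using forward conn_refl by metis
  next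
    case False
    then have "conn src dst E (src e) (dst e)" using forward by (auto intro: conn_edge)
    then show ?thesis using forward conn_trans by metis
  qed
next
  case (backward e)
  show ?case
  proof (cases "e = t")
    case True then show ?thesis using backward conn_refl by metis
  next
    case False
    then have "conn src dst E (dst e) (src e)" using backward by (auto intro: conn_edge conn_sym)
    then show ?thesis using backward conn_trans by metis
  qed
qed

lemma ncomp_cong:
  assumes "\<And>u v. conn src dst E u v \<longleftrightarrow> conn src dst F u v"
  shows "ncomp n src dst E = ncomp n src dst F"
  using assms by (simp add: ncomp_def)

text \<open>The components of \<open>F\<close> refine those of \<open>E\<close>, so sending an
  \<open>F\<close>-component to the nodes that \<open>E\<close> connects to it maps onto the
  \<open>E\<close>-components. This map \<open>h\<close> identifies the distinct components of
  \<open>a\<close> and \<open>b\<close>; being surjective but not injective, it makes the count drop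
  strictly.\<close>

lemma ncomp_less:
  assumes sub: "\<And>u v. conn src dst F u v \<Longrightarrow> conn src dst E u v"
    and ab: "a < n" "b < n" "conn src dst E a b" "\<not> conn src dst F a b"
  shows "ncomp n src dst E < ncomp n src dst F"
proof -
  define cE where "cE v = {w. w < n \<and> conn src dst E v w}" for v
  define cF where "cF v = {w. w < n \<and> conn src dst F v w}" for v
  define h where "h X = {w. w < n \<and> (\<exists>x\<in>X. conn src dst E x w)}" for X
  have hc: "h (cF v) = cE v" if "v < n" for v
    using that unfolding h_def cF_def cE_def
    by (auto intro: conn_refl conn_trans dest: sub)
  have img: "cE ` {..<n} = h ` (cF ` {..<n})"
    using hc by (force simp: image_image)
  have "cE a = cE b"
    using ab(3) unfolding cE_def by (auto intro: conn_trans conn_sym)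
  moreover have "cF a \<noteq> cF b"
    using ab conn_refl conn_sym unfolding cF_def by blast
  ultimately have "\<not> inj_on h (cF ` {..<n})"
    using hc ab(1,2) unfolding inj_on_def by (metis imageI lessThan_iff)
  then have "card (cE ` {..<n}) < card (cF ` {..<n})"
    unfolding img by (metis card_image_le eq_card_imp_inj_on finite_imageI finite_lessThan le_neq_implies_less)
  then show ?thesis unfolding ncomp_def cE_def cF_def .
qed

section \<open>Simple paths and fundamental loops\<close>

text \<open>Loop erasure, one branch at a time: a simple path is extended if the next node
  \<open>z\<close> is new, and cut back to the earlier visit of \<open>z\<close> if it is
  not.\<close>

lemma simple_path_exists:
  assumes "conn src dst T x y"
  shows "\<exists>es ds vs. length ds = length es \<and> length vs = Suc (length es) \<and> distinct vs \<and>
    set es \<subseteq> T \<and> vs ! 0 = x \<and> vs ! length es = y \<and>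
    (\<forall>j<length es.
       (ds!j \<and> src (es!j) = vs!j \<and> dst (es!j) = vs!Suc j) \<or>
       (\<not> ds!j \<and> dst (es!j) = vs!j \<and> src (es!j) = vs!Suc j))"
    (is "\<exists>es ds vs. ?P es ds vs y")
proof -
  have step: "\<exists>es ds vs. ?P es ds vs z"
    if P: "?P es ds vs y" and e: "e \<in> T"
      "(d \<and> src e = y \<and> dst e = z) \<or> (\<not> d \<and> dst e = y \<and> src e = z)"
    for es ds vs y z e d
  proof (cases "z \<in> set vs")
    case True
    then obtain k where k: "k \<le> length es" "vs ! k = z"
      using P by (auto simp: in_set_conv_nth less_Suc_eq_le)
    have "?P (take k es) (take k ds) (take (Suc k) vs) z"
      using P k set_take_subset[of k es] by (auto simp: min_def)
    then show ?thesis by blast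
  next
    case False
    have "?P (es @ [e]) (ds @ [d]) (vs @ [z]) z"
      using P e False by (auto simp: nth_append less_Suc_eq)
    then show ?thesis by blast
  qed
  show ?thesis using assms
  proof (induction rule: conn_induct)
    case refl
    have "?P [] [] [x] x" by simp
    then show ?case by blast
  next
    case (forward e)
    then obtain es ds vs where "?P es ds vs (src e)" by blast
    then show ?case by (rule step[where e = e and d = True]) (use forward in auto)
  next
    case (backward e)
    then obtain es ds vs where "?P es ds vs (dst e)" by blast
    then show ?case by (rule step[where e = e and d = False]) (use backward in auto)
  qed
qed

text \<open>A simple path inside \<open>T\<close> from the head of \<open>e\<close> back to its tail
  is closed up by \<open>e\<close> itself, which is therefore the only branch of the loop outside
  \<open>T\<close>.\<close>

lemma fundamental_loop:
  assumes T: "T \<subseteq> {..<m}" and e: "e < m" "e \<notin> T" and c: "conn src dst T (dst e) (src e)"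
  shows "\<exists>x. loop_vec n m src dst x \<and> x $ e = 1 \<and> (\<forall>b<m. b \<notin> T \<longrightarrow> b \<noteq> e \<longrightarrow> x $ b = 0)"
proof -
  obtain es ds vs where P: "length ds = length es" "length vs = Suc (length es)" "distinct vs"
    "set es \<subseteq> T" "vs ! 0 = dst e" "vs ! length es = src e"
    and step: "\<And>j. j < length es \<Longrightarrow>
       (ds!j \<and> src (es!j) = vs!j \<and> dst (es!j) = vs!Suc j) \<or>
       (\<not> ds!j \<and> dst (es!j) = vs!j \<and> src (es!j) = vs!Suc j)"
    using simple_path_exists[OF c] by blast
  \<comment> \<open>A branch used at positions \<open>i < j\<close> has \<open>vs ! i\<close> among
    its ends, so this node occurs again as \<open>vs ! j\<close> or \<open>vs ! Suc j\<close>,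
    against the simplicity of the path.\<close>
  have "es ! i \<noteq> es ! j" if "i < j" "j < length es" for i j
  proof
    assume "es ! i = es ! j"
    then have "vs ! i = vs ! j \<or> vs ! i = vs ! Suc j"
      using step[of i] step[of j] that by auto
    then show False using that P(2,3) by (auto simp: nth_eq_iff_index_eq)
  qed
  then have des: "distinct es"
    unfolding distinct_conv_nth by (metis nat_neq_iff)
  \<comment> \<open>The path has one node more than it has branches, so after appending
    \<open>e\<close> the list \<open>vs\<close> has the right length for the loop. The reduction
    modulo the length sends the last step, along \<open>e\<close>, back to
    \<open>vs ! 0 = dst e\<close>. A self-loop \<open>e\<close> is covered with an empty
    path.\<close>
  define es' where "es' = es @ [e]"
  define ds' where "ds' = ds @ [True]"
  define x where "x = vec m (\<lambda>b. \<Sum>j<length es'. if es'!j = b then (if ds'!j then 1 else -1 :: real) else 0)"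
  have len: "length es' = Suc (length es)" by (simp add: es'_def)
  have steps: "(ds'!j \<and> src (es'!j) = vs!j \<and> dst (es'!j) = vs!((j+1) mod length es')) \<or>
      (\<not> ds'!j \<and> dst (es'!j) = vs!j \<and> src (es'!j) = vs!((j+1) mod length es'))"
    if "j < length es'" for j
  proof (cases "j = length es")
    case True
    then show ?thesis using P by (simp add: es'_def ds'_def nth_append)
  next
    case False
    then have "j < length es" using that len by simp
    then show ?thesis using step[of j] P(1) by (simp add: es'_def ds'_def nth_append)
  qed
  have loop: "loop_vec n m src dst x"
    unfolding loop_vec_def
  proof (rule exI[of _ es'], rule exI[of _ ds'], rule exI[of _ vs], intro conjI)
    show "distinct es'" using des P(4) e by (auto simp: es'_def)
    show "set es' \<subseteq> {..<m}" using P(4) T e by (auto simp: es'_def)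
    show "\<forall>j<length es'. (ds'!j \<and> src (es'!j) = vs!j \<and> dst (es'!j) = vs!((j+1) mod length es')) \<or>
      (\<not> ds'!j \<and> dst (es'!j) = vs!j \<and> src (es'!j) = vs!((j+1) mod length es'))"
      using steps by blast
    show "x = vec m (\<lambda>b. \<Sum>j<length es'. if es'!j = b then (if ds'!j then 1 else -1) else 0)"
      by (rule x_def)
  qed (use P in \<open>auto simp: es'_def ds'_def\<close>)
  have inT: "es' ! j \<in> T" if "j < length es" for j
    using that P(4) by (auto simp: es'_def nth_append)
  have last: "es' ! length es = e" "ds' ! length es"
    using P(1) by (auto simp: es'_def ds'_def nth_append)
  have "x $ e = (\<Sum>j<length es. if es'!j = e then (if ds'!j then 1 else -1 :: real) else 0) + 1"
    using e(1) last by (simp add: x_def len)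
  also have "(\<Sum>j<length es. if es'!j = e then (if ds'!j then 1 else -1 :: real) else 0) = 0"
    using inT e(2) by (intro sum.neutral) auto
  finally have "x $ e = 1" by simp
  moreover have "x $ b = 0" if "b < m" "b \<notin> T" "b \<noteq> e" for b
  proof -
    have "es' ! j \<noteq> b" if "j < length es'" for j
      using that inT[of j] last \<open>b \<notin> T\<close> \<open>b \<noteq> e\<close> len by (cases "j = length es") auto
    then show ?thesis using that(1) by (simp add: x_def)
  qed
  ultimately show ?thesis using loop by blast
qed

text \<open>The signs of the loop vector turn each branch term into the drop of \<open>p\<close>
  from one node of the loop to the next, and these drops cancel around the loop.\<close>

lemma loop_vec_orth_potential:
  fixes p :: "nat \<Rightarrow> real"
  assumes "loop_vec n m src dst x"
  shows "(\<Sum>b<m. x $ b * (p (src b) - p (dst b))) = 0"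
proof -
  obtain es ds vs where L: "0 < length es" "set es \<subseteq> {..<m}"
    and step: "\<And>j. j<length es \<Longrightarrow>
           (ds!j \<and> src (es!j) = vs!j \<and> dst (es!j) = vs!((j+1) mod length es)) \<or>
           (\<not> ds!j \<and> dst (es!j) = vs!j \<and> src (es!j) = vs!((j+1) mod length es))"
    and x: "x = vec m (\<lambda>b. \<Sum>j<length es. if es!j = b then (if ds!j then 1 else -1) else 0)"
    using assms unfolding loop_vec_def by blast
  define L where "L = length es"
  define q where "q b = p (src b) - p (dst b)" for b
  have mem: "es ! j < m" if "j < L" for j
    using that \<open>set es \<subseteq> {..<m}\<close> unfolding L_def by (meson lessThan_iff nth_mem subsetD)
  have "(\<Sum>b<m. x $ b * q b) =
      (\<Sum>b<m. \<Sum>j<L. if es!j = b then (if ds!j then q b else - q b) else 0)"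
    by (auto simp: x L_def sum_distrib_right intro!: sum.cong)
  also have "\<dots> = (\<Sum>j<L. \<Sum>b<m. if es!j = b then (if ds!j then q b else - q b) else 0)"
    by (rule sum.swap)
  also have "\<dots> = (\<Sum>j<L. if ds!j then q (es!j) else - q (es!j))"
    using mem by (intro sum.cong) (auto simp: sum.delta)
  also have "\<dots> = (\<Sum>j<L. p (vs!j) - p (vs!(Suc j mod L)))"
    using step by (intro sum.cong) (fastforce simp: q_def L_def)+
  also have "\<dots> = (\<Sum>j<L. p (vs!j)) - (\<Sum>j<L. p (vs!(Suc j mod L)))"
    by (rule sum_subtractf)
  \<comment> \<open>The cyclic successor permutes the positions: the term of \<open>vs ! 0\<close>
    moves to the end of the sum. That \<open>L\<close> is positive makes this last position
    exist.\<close>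
  also have "(\<Sum>j<L. p (vs!(Suc j mod L))) = (\<Sum>j<L. p (vs!j))"
  proof -
    obtain k where k: "L = Suc k" using L by (cases L) (auto simp: L_def)
    have "(\<Sum>j<L. p (vs!(Suc j mod L))) = (\<Sum>j<k. p (vs!(Suc j mod L))) + p (vs!0)"
      by (simp add: k)
    also have "(\<Sum>j<k. p (vs!(Suc j mod L))) = (\<Sum>j<k. p (vs!(Suc j)))"
      by (intro sum.cong) (auto simp: k)
    also have "\<dots> + p (vs!0) = (\<Sum>j<L. p (vs!j))"
      unfolding k by (subst sum.lessThan_Suc_shift) simp
    finally show ?thesis .
  qed
  finally show ?thesis by (simp add: q_def)
qed

section \<open>Fundamental cutsets\<close>

text \<open>Deleting \<open>t\<close> from \<open>T\<close> splits a component in two. With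
  \<open>S\<close> the side of \<open>src t\<close>, the branches between \<open>S\<close> and its
  complement form a cutset that meets \<open>T\<close> only in \<open>t\<close>. Its vector is the
  potential difference of the indicator function of \<open>S\<close>, hence the witness
  \<open>p\<close>.\<close>

lemma fundamental_cutset:
  assumes graph: "digraph_ok n m src dst" and T: "T \<subseteq> {..<m}" and t: "t \<in> T"
    and spanning: "\<And>e. e < m \<Longrightarrow> conn src dst T (src e) (dst e)"
    and bridge: "\<not> conn src dst (T - {t}) (src t) (dst t)"
  shows "\<exists>x p. cutset_vec n m src dst x \<and> (\<forall>b<m. x $ b = p (src b) - p (dst b)) \<and>
    x $ t = 1 \<and> (\<forall>b\<in>T - {t}. x $ b = 0)"
proof -
  define S where "S = {w. w < n \<and> conn src dst (T - {t}) (src t) w}"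
  define C where "C = {e. e < m \<and> (src e \<in> S) \<noteq> (dst e \<in> S)}"
  define x :: "real vec" where "x = vec m (\<lambda>e. if src e \<in> S \<and> dst e \<notin> S then 1
                         else if dst e \<in> S \<and> src e \<notin> S then -1 else 0)"
  have lt: "src e < n" "dst e < n" if "e < m" for e
    using graph that by (auto simp: digraph_ok_def)
  have tm: "t < m" using T t by auto
  have stS: "src t \<in> S" "dst t \<notin> S"
    using lt[OF tm] bridge by (auto simp: S_def conn_refl)
  have TS: "src e \<in> S \<longleftrightarrow> dst e \<in> S" if "e \<in> T - {t}" for e
    using conn_edge[OF that, of src dst] conn_sym[OF conn_edge[OF that, of src dst]] that T lt[of e]
    unfolding S_def by (auto intro: conn_trans)
  have TC: "T - {t} \<subseteq> {..<m} - C"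
    using TS T by (auto simp: C_def)
  \<comment> \<open>Without \<open>C\<close> no branch leaves \<open>S\<close>, and
    \<open>T - {t}\<close> survives the removal of \<open>C\<close> and still connects all of
    \<open>S\<close>.\<close>
  have comp: "{w. w < n \<and> conn src dst ({..<m} - C) (src t) w} = S"
  proof -
    have "w \<in> S" if "conn src dst ({..<m} - C) (src t) w" for w
      using conn_closed[OF that, of S] stS by (auto simp: C_def)
    then show ?thesis using TC by (auto simp: S_def intro: conn_mono)
  qed
  have all_T: "conn src dst T u v" if "conn src dst {..<m} u v" for u v
    using that by (rule conn_overlay) (use spanning in auto)
  have "is_cutset n m src dst C"
    unfolding is_cutset_def
  proof (intro conjI allI impI)
    show "C \<subseteq> {..<m}" by (auto simp: C_def)
    show "ncomp n src dst {..<m} < ncomp n src dst ({..<m} - C)"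
    proof (rule ncomp_less)
      show "conn src dst {..<m} (src t) (dst t)" using tm by (auto intro: conn_edge)
      show "\<not> conn src dst ({..<m} - C) (src t) (dst t)"
        using comp stS lt[OF tm] by blast
    qed (use lt[OF tm] in \<open>auto intro: conn_mono\<close>)
    \<comment> \<open>Minimality: a branch \<open>e\<close> of \<open>C\<close> that is kept joins
      both sides again. It reconnects the ends of \<open>t\<close>, hence everything that
      \<open>T\<close> connects, and no component is gained.\<close>
    fix C' assume C': "C' \<subset> C"
    then obtain e where e: "e \<in> C" "e \<notin> C'" by blast
    let ?F = "{..<m} - C'"
    have em: "e < m" and eF: "e \<in> ?F" using e by (auto simp: C_def)
    have TF: "conn src dst ?F u v" if "conn src dst (T - {t}) u v" for u v
      using that TC C' by (auto elim!: conn_mono)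
    \<comment> \<open>A node outside \<open>S\<close> that \<open>T\<close> connects to
      \<open>src t\<close> is reached only through \<open>t\<close>, so it lies on the side of
      \<open>dst t\<close>.\<close>
    have other: "conn src dst (T - {t}) (dst t) w"
      if "w < n" "w \<notin> S" "conn src dst T (src t) w" for w
    proof -
      have "insert t (T - {t}) = T" using t by auto
      then have "conn src dst (insert t (T - {t})) (src t) w" using that by simp
      then show ?thesis using conn_insert_cases[of src dst t "T - {t}" "src t" w] that bridge
        by (auto simp: S_def)
    qed
    have S_T: "conn src dst T (src t) w" if "w \<in> S" for w
      using that by (auto simp: S_def intro: conn_mono)
    \<comment> \<open>The surviving branch \<open>e\<close> is read from its end \<open>a\<close> in
      \<open>S\<close> to its end \<open>c\<close> outside, whichever way it is oriented.\<close>
    obtain a c where ac: "a \<in> S" "c \<notin> S" "c < n" "conn src dst T a c" "conn src dst ?F a c"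
    proof (cases "src e \<in> S")
      case True
      then show ?thesis using that[of "src e" "dst e"] e em lt[OF em] spanning[OF em]
          conn_edge[OF eF] by (auto simp: C_def)
    next
      case False
      then show ?thesis using that[of "dst e" "src e"] e em lt[OF em] conn_sym[OF spanning[OF em]]
          conn_sym[OF conn_edge[OF eF]] by (auto simp: C_def)
    qed
    have "conn src dst ?F (src t) a" using ac(1) by (auto simp: S_def intro: TF)
    moreover have "conn src dst ?F (dst t) c"
      by (intro TF other ac) (rule conn_trans[OF S_T[OF ac(1)] ac(4)])
    ultimately have tF: "conn src dst ?F (src t) (dst t)"
      using ac(5) conn_trans conn_sym by metis
    \<comment> \<open>The branches of \<open>T - {t}\<close> lie outside \<open>C\<close> and are
      kept; \<open>t\<close> itself is bypassed by the path through \<open>a\<close> and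
      \<open>c\<close>.\<close>
    have "conn src dst ?F (src f) (dst f)" if "f \<in> T" for f
      using tF TF[OF conn_edge[of f]] that by (cases "f = t") auto
    then have "conn src dst ?F u v" if "conn src dst {..<m} u v" for u v
      by (rule conn_overlay[OF all_T[OF that]])
    then have "ncomp n src dst ?F = ncomp n src dst {..<m}"
      by (intro ncomp_cong) (auto intro: conn_mono)
    then show "\<not> ncomp n src dst {..<m} < ncomp n src dst ?F" by simp
  qed
  then have "cutset_vec n m src dst x"
    unfolding cutset_vec_def Let_def using lt(1)[OF tm]
    by (intro exI[of _ C] exI[of _ "src t"], unfold comp) (auto simp: C_def x_def)
  moreover have "\<forall>b<m. x $ b = of_bool (src b \<in> S) - of_bool (dst b \<in> S)"
    by (auto simp: x_def)
  moreover have "x $ t = 1" using tm stS by (simp add: x_def)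
  moreover have "x $ b = 0" if "b \<in> T - {t}" for b
  proof -
    have "b < m" using that T by auto
    then show ?thesis using TS[OF that] by (simp add: x_def)
  qed
  ultimately show ?thesis
    by (intro exI[of _ x] exI[of _ "\<lambda>w. of_bool (w \<in> S)"]) auto
qed

section \<open>Spanning forests and Tellegen's theorem\<close>

text \<open>A set of least cardinality that connects the ends of every branch: if the ends of some
  \<open>t\<close> in \<open>T\<close> stayed connected without \<open>t\<close>, then
  \<open>T - {t}\<close> would be a smaller such set.\<close>

lemma spanning_forest_exists:
  obtains T where "T \<subseteq> {..<m}" "\<And>e. e < m \<Longrightarrow> conn src dst T (src e) (dst e)"
    "\<And>t. t \<in> T \<Longrightarrow> \<not> conn src dst (T - {t}) (src t) (dst t)"
proof -
  define Q where "Q T \<longleftrightarrow> T \<subseteq> {..<m} \<and> (\<forall>e<m. conn src dst T (src e) (dst e))" for T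
  have "Q {..<m}" by (auto simp: Q_def intro: conn_edge)
  from ex_has_least_nat[of Q, OF this, of card]
  obtain T where T: "Q T" and min: "\<And>T'. Q T' \<Longrightarrow> card T \<le> card T'" by blast
  have fin: "finite T" using T finite_subset by (auto simp: Q_def)
  show thesis
  proof
    show "T \<subseteq> {..<m}" "\<And>e. e < m \<Longrightarrow> conn src dst T (src e) (dst e)"
      using T by (auto simp: Q_def)
    fix t assume t: "t \<in> T"
    show "\<not> conn src dst (T - {t}) (src t) (dst t)"
    proof
      assume c: "conn src dst (T - {t}) (src t) (dst t)"
      have "conn src dst (T - {t}) (src f) (dst f)" if "f \<in> T" for f
        using c conn_edge[of f "T - {t}"] that by (cases "f = t") auto
      then have "conn src dst (T - {t}) u v" if "conn src dst T u v" for u v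
        by (rule conn_overlay[OF that])
      then have "Q (T - {t})" using T by (auto simp: Q_def)
      then show False using min[of "T - {t}"] t fin
        by (metis card_Diff1_less leD)
    qed
  qed
qed

lemma tellegen:
  fixes v i :: "nat \<Rightarrow> real"
  assumes graph: "digraph_ok n m src dst"
    and v: "\<And>x. loop_vec n m src dst x \<Longrightarrow> (\<Sum>b<m. x $ b * v b) = 0"
    and i: "\<And>x. cutset_vec n m src dst x \<Longrightarrow> (\<Sum>b<m. x $ b * i b) = 0"
  shows "(\<Sum>b<m. v b * i b) = 0"
proof -
  obtain T where T: "T \<subseteq> {..<m}" "\<And>e. e < m \<Longrightarrow> conn src dst T (src e) (dst e)"
    "\<And>t. t \<in> T \<Longrightarrow> \<not> conn src dst (T - {t}) (src t) (dst t)"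
    using spanning_forest_exists[where m = m and src = src and dst = dst] by blast
  have fin: "finite T" using T(1) finite_subset by blast
  have "\<forall>t\<in>T. \<exists>x p. cutset_vec n m src dst x \<and> (\<forall>b<m. x $ b = p (src b) - p (dst b)) \<and>
    x $ t = 1 \<and> (\<forall>b\<in>T - {t}. x $ b = 0)"
    using fundamental_cutset[OF graph T(1) _ T(2,3)] by blast
  then obtain c p where c: "\<And>t. t \<in> T \<Longrightarrow> cutset_vec n m src dst (c t)"
    and p: "\<And>t b. t \<in> T \<Longrightarrow> b < m \<Longrightarrow> c t $ b = p t (src b) - p t (dst b)"
    and c1: "\<And>t. t \<in> T \<Longrightarrow> c t $ t = 1" and c0: "\<And>t b. t \<in> T \<Longrightarrow> b \<in> T - {t} \<Longrightarrow> c t $ b = 0"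
    by metis
  define w where "w b = v b - (\<Sum>t\<in>T. v t * c t $ b)" for b
  have wT: "w b = 0" if "b \<in> T" for b
  proof -
    have "(\<Sum>t\<in>T. v t * c t $ b) = (\<Sum>t\<in>T. if t = b then v b else 0)"
      using c1 c0 that by (intro sum.cong) auto
    then show ?thesis using that fin by (simp add: w_def)
  qed
  have w_loop: "(\<Sum>b<m. x $ b * w b) = 0" if x: "loop_vec n m src dst x" for x
  proof -
    have "(\<Sum>b<m. x $ b * (\<Sum>t\<in>T. v t * c t $ b)) = (\<Sum>b<m. \<Sum>t\<in>T. v t * (x $ b * c t $ b))"
      by (simp add: sum_distrib_left mult.left_commute)
    also have "\<dots> = (\<Sum>t\<in>T. v t * (\<Sum>b<m. x $ b * c t $ b))"
      by (subst sum.swap) (simp add: sum_distrib_left)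
    \<comment> \<open>Each \<open>c t\<close> is a potential difference, so it is orthogonal to
      every loop.\<close>
    also have "\<dots> = 0"
      using loop_vec_orth_potential[OF x] p by (intro sum.neutral) simp
    finally show ?thesis using v[OF x] by (simp add: w_def right_diff_distrib sum_subtractf)
  qed
  have w0: "w e = 0" if e: "e < m" for e
  proof (cases "e \<in> T")
    case False
    obtain x where x: "loop_vec n m src dst x" "x $ e = 1"
      "\<And>b. b < m \<Longrightarrow> b \<notin> T \<Longrightarrow> b \<noteq> e \<Longrightarrow> x $ b = 0"
      using fundamental_loop[OF T(1) e False conn_sym[OF T(2)[OF e]]] by blast
    have "0 = (\<Sum>b<m. x $ b * w b)" using w_loop[OF x(1)] by simp
    \<comment> \<open>Apart from \<open>e\<close>, the support of the fundamental loop lies in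
      \<open>T\<close>, where \<open>w\<close> vanishes; only the term \<open>w e\<close> is
      left.\<close>
    also have "\<dots> = (\<Sum>b<m. if b = e then w e else 0)"
      using x(2,3) wT by (intro sum.cong) auto
    finally show ?thesis using e by simp
  qed (rule wT)
  have "(\<Sum>b<m. v b * i b) = (\<Sum>b<m. \<Sum>t\<in>T. v t * (c t $ b * i b))"
    using w0 by (intro sum.cong) (auto simp: w_def sum_distrib_right mult.assoc)
  also have "\<dots> = (\<Sum>t\<in>T. v t * (\<Sum>b<m. c t $ b * i b))"
    by (subst sum.swap) (simp add: sum_distrib_left)
  also have "\<dots> = 0" using i[OF c] by simp
  finally show ?thesis .
qed

subsection \<open>Dimensions of matrix kernels\<close>

lemma kernel_fin_dim:
  assumes "A \<in> carrier_mat nr nc"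
  shows "vectorspace.fin_dim class_ring ((module_vec TYPE('a::field) nc)\<lparr>carrier := mat_kernel (A :: 'a mat)\<rparr>)"
proof -
  interpret K: kernel nr nc A by unfold_locales (rule assms)
  show ?thesis
    using kernel_basis_exists[OF assms] unfolding K.Ker.fin_dim_def K.Ker.basis_def by auto
qed

lemma mat_kernel_append_rows:
  assumes A: "A \<in> carrier_mat nr nc" and P: "P \<in> carrier_mat np nc"
  shows "mat_kernel (A @\<^sub>r P) = {z \<in> mat_kernel A. P *\<^sub>v z = 0\<^sub>v np}"
proof -
  have "(A @\<^sub>r P) *\<^sub>v z = 0\<^sub>v (nr + np) \<longleftrightarrow> A *\<^sub>v z = 0\<^sub>v nr \<and> P *\<^sub>v z = 0\<^sub>v np"
    if z: "z \<in> carrier_vec nc" for z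
  proof -
    have "0\<^sub>v (nr + np) = 0\<^sub>v nr @\<^sub>v (0\<^sub>v np :: 'a vec)" by auto
    moreover have "A *\<^sub>v z \<in> carrier_vec nr" "P *\<^sub>v z \<in> carrier_vec np"
      using A P z by auto
    ultimately show ?thesis
      unfolding mat_mult_append[OF A P z] by (simp add: append_vec_eq[where n = nr])
  qed
  then show ?thesis
    unfolding mat_kernel[OF carrier_append_rows[OF A P]] mat_kernel[OF A] by auto
qed

text \<open>Rank-nullity for \<open>P\<close> restricted to the kernel of \<open>A\<close>: the
  image is the kernel of \<open>C\<close>, and the kernel of the restriction is that of
  \<open>A\<close> stacked on \<open>P\<close>.\<close>

lemma kernel_dim_append_rows:
  fixes A P C :: "'a :: field mat"
  assumes A: "A \<in> carrier_mat nr nc" and P: "P \<in> carrier_mat np nc" and C: "C \<in> carrier_mat nr' np"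
    and img: "(*\<^sub>v) P ` mat_kernel A = mat_kernel C"
  shows "kernel_dim A = kernel_dim C + kernel_dim (A @\<^sub>r P)"
proof -
  interpret KA: kernel nr nc A by unfold_locales (rule A)
  interpret KC: kernel nr' np C by unfold_locales (rule C)
  interpret KP: kernel "nr + np" nc "A @\<^sub>r P" by unfold_locales (rule carrier_append_rows[OF A P])
  have hom: "(*\<^sub>v) P \<in> LinearCombinations.module_hom class_ring KA.VK KC.VK"
    using img mult_add_distrib_mat_vec[OF P] mult_mat_vec[OF P] mat_kernelD(1)[OF A]
    unfolding LinearCombinations.module_hom_def by (auto simp: class_ring_simps)
  interpret T: linear_map class_ring KA.VK KC.VK "(*\<^sub>v) P"
    by (intro linear_map.intro mod_hom.intro mod_hom_axioms.intro KA.Ker.vectorspace_axioms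
        KC.Ker.vectorspace_axioms KA.Ker.module_axioms KC.Ker.module_axioms hom)
  have im: "T.imT = mat_kernel C" unfolding T.im_def using img by simp
  have ker: "T.kerT = mat_kernel (A @\<^sub>r P)"
    unfolding T.ker_def mat_kernel_append_rows[OF A P] by simp
  have "vectorspace.dim class_ring (KC.VK\<lparr>carrier := T.imT\<rparr>)
      + vectorspace.dim class_ring (KA.VK\<lparr>carrier := T.kerT\<rparr>) = KA.dim"
    by (rule T.rank_nullity[OF kernel_fin_dim[OF A]])
  then show ?thesis
    unfolding im ker by simp
qed

text \<open>The kernel of a matrix without rows is the whole space. This lets an unconstrained
  component be treated as a kernel too.\<close>

lemma kernel_dim_no_rows: "kernel_dim (0\<^sub>m 0 k :: 'a :: field mat) = k"
proof -
  interpret K: kernel 0 k "0\<^sub>m 0 k :: 'a mat" by unfold_locales auto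
  have "mat_kernel (0\<^sub>m 0 k :: 'a mat) = carrier_vec k"
    by (auto simp: mat_kernel_def)
  then have "K.VK = K.NC.V" by (simp add: module_vec_def)
  then show ?thesis using K.NC.dim_is_n by simp
qed

lemma kernel_dim_trivial:
  assumes A: "A \<in> carrier_mat nr nc" and triv: "mat_kernel A = {0\<^sub>v nc}"
  shows "kernel_dim A = 0"
proof -
  interpret K: kernel nr nc A by unfold_locales (rule A)
  have "K.basis {}"
    unfolding K.Ker.basis_def K.Ker.span_empty K.Ker.lin_dep_def using triv by auto
  then show ?thesis using K.Ker.dim_basis[of "{}"] by simp
qed

text \<open>\<open>P0\<close>, \<open>P1\<close>, \<open>P2\<close> together identify the kernel of
  \<open>A\<close> with the product of the full space of dimension \<open>k0\<close> and the kernels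
  of \<open>C1\<close> and \<open>C2\<close>. The three blocks are stacked below \<open>A\<close>
  one after another, and rank-nullity splits off one factor each time; \<open>onto\<close> is
  applied with zeros in the components already killed, and \<open>inj\<close> says that nothing
  remains at the end.\<close>

lemma kernel_dim_three_summands:
  fixes A P0 P1 P2 C1 C2 :: "'a :: field mat"
  assumes A: "A \<in> carrier_mat nr nc"
    and P: "P0 \<in> carrier_mat k0 nc" "P1 \<in> carrier_mat k1 nc" "P2 \<in> carrier_mat k2 nc"
    and C: "C1 \<in> carrier_mat r1 k1" "C2 \<in> carrier_mat r2 k2"
    and into: "\<And>z. z \<in> mat_kernel A \<Longrightarrow> P1 *\<^sub>v z \<in> mat_kernel C1 \<and> P2 *\<^sub>v z \<in> mat_kernel C2"
    and onto: "\<And>y0 y1 y2. y0 \<in> carrier_vec k0 \<Longrightarrow> y1 \<in> mat_kernel C1 \<Longrightarrow> y2 \<in> mat_kernel C2 \<Longrightarrow>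
      \<exists>z\<in>mat_kernel A. P0 *\<^sub>v z = y0 \<and> P1 *\<^sub>v z = y1 \<and> P2 *\<^sub>v z = y2"
    and inj: "\<And>z. z \<in> mat_kernel A \<Longrightarrow> P0 *\<^sub>v z = 0\<^sub>v k0 \<Longrightarrow> P1 *\<^sub>v z = 0\<^sub>v k1 \<Longrightarrow> P2 *\<^sub>v z = 0\<^sub>v k2
      \<Longrightarrow> z = 0\<^sub>v nc"
  shows "kernel_dim A = k0 + kernel_dim C1 + kernel_dim C2"
proof -
  note A0 = carrier_append_rows[OF A P(1)]
  note A1 = carrier_append_rows[OF A0 P(2)]
  note A2 = carrier_append_rows[OF A1 P(3)]
  note ker = mat_kernel_append_rows[OF A P(1)] mat_kernel_append_rows[OF A0 P(2)]
    mat_kernel_append_rows[OF A1 P(3)]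
  have C0: "(0\<^sub>m 0 k0 :: 'a mat) \<in> carrier_mat 0 k0" by simp
  have k0: "mat_kernel (0\<^sub>m 0 k0 :: 'a mat) = carrier_vec k0" by (auto simp: mat_kernel_def)
  have zero: "0\<^sub>v k1 \<in> mat_kernel C1" "0\<^sub>v k2 \<in> mat_kernel C2"
    using C by (auto simp: mat_kernel_def)
  have "(*\<^sub>v) P0 ` mat_kernel A = mat_kernel (0\<^sub>m 0 k0)"
  proof
    show "(*\<^sub>v) P0 ` mat_kernel A \<subseteq> mat_kernel (0\<^sub>m 0 k0)"
      unfolding k0 using P(1) mat_kernelD(1)[OF A] by auto
    show "mat_kernel (0\<^sub>m 0 k0) \<subseteq> (*\<^sub>v) P0 ` mat_kernel A"
      unfolding k0 using onto[OF _ zero] by fast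
  qed
  from kernel_dim_append_rows[OF A P(1) C0 this]
  have 0: "kernel_dim A = k0 + kernel_dim (A @\<^sub>r P0)" by (simp add: kernel_dim_no_rows)
  have "(*\<^sub>v) P1 ` mat_kernel (A @\<^sub>r P0) = mat_kernel C1"
  proof
    show "(*\<^sub>v) P1 ` mat_kernel (A @\<^sub>r P0) \<subseteq> mat_kernel C1" unfolding ker using into by auto
    show "mat_kernel C1 \<subseteq> (*\<^sub>v) P1 ` mat_kernel (A @\<^sub>r P0)"
      unfolding ker using onto[OF zero_carrier_vec _ zero(2)] by fast
  qed
  from kernel_dim_append_rows[OF A0 P(2) C(1) this]
  have 1: "kernel_dim (A @\<^sub>r P0) = kernel_dim C1 + kernel_dim ((A @\<^sub>r P0) @\<^sub>r P1)" .
  have "(*\<^sub>v) P2 ` mat_kernel ((A @\<^sub>r P0) @\<^sub>r P1) = mat_kernel C2"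
  proof
    show "(*\<^sub>v) P2 ` mat_kernel ((A @\<^sub>r P0) @\<^sub>r P1) \<subseteq> mat_kernel C2" unfolding ker using into by auto
    show "mat_kernel C2 \<subseteq> (*\<^sub>v) P2 ` mat_kernel ((A @\<^sub>r P0) @\<^sub>r P1)"
      unfolding ker using onto[OF zero_carrier_vec zero(1)] by fast
  qed
  from kernel_dim_append_rows[OF A1 P(3) C(2) this]
  have 2: "kernel_dim ((A @\<^sub>r P0) @\<^sub>r P1)
    = kernel_dim C2 + kernel_dim (((A @\<^sub>r P0) @\<^sub>r P1) @\<^sub>r P2)" .
  have "mat_kernel (((A @\<^sub>r P0) @\<^sub>r P1) @\<^sub>r P2) = {0\<^sub>v nc}"
  proof
    show "mat_kernel (((A @\<^sub>r P0) @\<^sub>r P1) @\<^sub>r P2) \<subseteq> {0\<^sub>v nc}" unfolding ker using inj by auto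
    show "{0\<^sub>v nc} \<subseteq> mat_kernel (((A @\<^sub>r P0) @\<^sub>r P1) @\<^sub>r P2)"
      unfolding ker using A P by (auto simp: mat_kernel_def)
  qed
  from kernel_dim_trivial[OF A2 this] show ?thesis using 0 1 2 by simp
qed

section \<open>Coordinate projections and column submatrices\<close>

text \<open>The selection of the coordinates \<open>\<sigma> 0, \<sigma> 1, ...\<close>, written as
  a matrix so that it can be stacked below another one.\<close>

definition coord_mat :: "nat \<Rightarrow> nat \<Rightarrow> (nat \<Rightarrow> nat) \<Rightarrow> 'a :: semiring_1 mat" where
  "coord_mat k nc \<sigma> = mat k nc (\<lambda>(j, c). if c = \<sigma> j then 1 else 0)"

lemma coord_mat_carrier [simp]: "coord_mat k nc \<sigma> \<in> carrier_mat k nc"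
  by (simp add: coord_mat_def)

lemma coord_mat_mult:
  assumes "z \<in> carrier_vec nc" and "\<And>j. j < k \<Longrightarrow> \<sigma> j < nc"
  shows "coord_mat k nc \<sigma> *\<^sub>v z = vec k (\<lambda>j. z $ \<sigma> j)"
proof (rule eq_vecI)
  fix j assume "j < dim_vec (vec k (\<lambda>j. z $ \<sigma> j))"
  then have j: "j < k" by simp
  have "(coord_mat k nc \<sigma> *\<^sub>v z) $ j = (\<Sum>c\<in>{0..<nc}. (if c = \<sigma> j then 1 else 0) * z $ c)"
    using j assms(1) by (auto simp: coord_mat_def scalar_prod_def intro!: sum.cong)
  also have "\<dots> = (\<Sum>c\<in>{0..<nc}. if c = \<sigma> j then z $ c else 0)"
    by (intro sum.cong) auto
  also have "\<dots> = z $ \<sigma> j" using assms(2)[OF j] by simp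
  finally show "(coord_mat k nc \<sigma> *\<^sub>v z) $ j = vec k (\<lambda>j. z $ \<sigma> j) $ j" using j by simp
qed (simp add: coord_mat_def)

text \<open>Counting the smaller elements of \<open>K\<close> inverts the increasing enumeration
  \<open>pick K\<close>.\<close>

lemma rank_bij_betw:
  assumes "finite (K :: nat set)"
  shows "bij_betw (\<lambda>b. card {a \<in> K. a < b}) K {..<card K}"
proof (rule bij_betw_byWitness[where f' = "pick K"])
  show "\<forall>b\<in>K. pick K (card {a \<in> K. a < b}) = b" by (simp add: pick_card_in_set)
  show "\<forall>j\<in>{..<card K}. card {a \<in> K. a < pick K j} = j" by (simp add: card_pick)
  show "(\<lambda>b. card {a \<in> K. a < b}) ` K \<subseteq> {..<card K}"
    using assms by (auto intro!: psubset_card_mono)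
  show "pick K ` {..<card K} \<subseteq> K" by (auto intro: pick_in_set)
qed

lemma sum_pick:
  assumes "finite K"
  shows "(\<Sum>j<card K. g j (pick K j)) = (\<Sum>b\<in>K. g (card {a \<in> K. a < b}) b)"
proof -
  have "(\<Sum>b\<in>K. g (card {a \<in> K. a < b}) (pick K (card {a \<in> K. a < b}))) = (\<Sum>j<card K. g j (pick K j))"
    by (rule sum.reindex_bij_betw[OF rank_bij_betw[OF assms]])
  then show ?thesis by (simp add: pick_card_in_set)
qed

text \<open>Vectors on the selected columns are read off a function \<open>w\<close> of the branches
  through \<open>pick\<close>. The kernel condition then becomes a sum over the branches of
  \<open>K\<close> and no longer mentions positions.\<close>

lemma mat_kernel_submatrix_cols:
  fixes B :: "'a :: comm_ring_1 mat"
  assumes K: "K \<subseteq> {..<dim_col B}"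
  shows "submatrix B {..<dim_row B} K \<in> carrier_mat (dim_row B) (card K)"
    and "vec (card K) (\<lambda>j. w (pick K j)) \<in> mat_kernel (submatrix B {..<dim_row B} K) \<longleftrightarrow>
      (\<forall>r<dim_row B. (\<Sum>b\<in>K. B $$ (r, b) * w b) = 0)"
proof -
  have rows: "{i. i < dim_row B \<and> i \<in> {..<dim_row B}} = {..<dim_row B}" by auto
  have cols: "{j. j < dim_col B \<and> j \<in> K} = K" using K by auto
  have fin: "finite K" using K finite_subset by blast
  have pick_row: "pick {..<d} r = r" if "r < d" for d r
  proof -
    have "{a \<in> {..<d}. a < r} = {..<r}" using that by auto
    then show ?thesis using pick_card_in_set[of r "{..<d}"] that by simp
  qed
  show S: "submatrix B {..<dim_row B} K \<in> carrier_mat (dim_row B) (card K)"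
    using dim_submatrix[of B "{..<dim_row B}" K] unfolding rows cols by (intro carrier_matI) auto
  have "(submatrix B {..<dim_row B} K *\<^sub>v vec (card K) (\<lambda>j. w (pick K j))) $ r
      = (\<Sum>b\<in>K. B $$ (r, b) * w b)" if r: "r < dim_row B" for r
  proof -
    have "(submatrix B {..<dim_row B} K *\<^sub>v vec (card K) (\<lambda>j. w (pick K j))) $ r
      = (\<Sum>j<card K. submatrix B {..<dim_row B} K $$ (r, j) * w (pick K j))"
      using S r by (auto simp: scalar_prod_def lessThan_atLeast0 intro!: sum.cong)
    also have "\<dots> = (\<Sum>j<card K. B $$ (r, pick K j) * w (pick K j))"
      using r submatrix_index[of r B "{..<dim_row B}" _ K] pick_row[OF r]
      unfolding rows cols by (intro sum.cong) auto
    also have "\<dots> = (\<Sum>b\<in>K. B $$ (r, b) * w b)" by (rule sum_pick[OF fin])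
    finally show ?thesis .
  qed
  then show "vec (card K) (\<lambda>j. w (pick K j)) \<in> mat_kernel (submatrix B {..<dim_row B} K) \<longleftrightarrow>
      (\<forall>r<dim_row B. (\<Sum>b\<in>K. B $$ (r, b) * w b) = 0)"
    unfolding mat_kernel[OF S] using S by (auto simp: vec_eq_iff)
qed

subsection \<open>The kernel of the Jacobian\<close>

text \<open>Class matrices are indexed by positions within a class, circuit quantities by branches.
  This is the matrix-vector product in branch terms; it is meant for branches \<open>b\<close> of
  class \<open>c\<close>.\<close>

definition class_mult :: "nat \<Rightarrow> (nat \<Rightarrow> dev) \<Rightarrow> dev \<Rightarrow> real mat \<Rightarrow> (nat \<Rightarrow> real) \<Rightarrow> nat \<Rightarrow> real" where
  "class_mult m cls c M x b = (\<Sum>b' | b' < m \<and> cls b' = c. M $$ (cpos cls b, cpos cls b') * x b')"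

definition class_vec :: "nat \<Rightarrow> (nat \<Rightarrow> dev) \<Rightarrow> dev \<Rightarrow> (nat \<Rightarrow> real) \<Rightarrow> real vec" where
  "class_vec m cls c x = vec (ncls m cls c) (\<lambda>j. x (pick {b. b < m \<and> cls b = c} j))"

lemma class_vec_carrier [simp]: "class_vec m cls c x \<in> carrier_vec (ncls m cls c)"
  by (simp add: class_vec_def)

text \<open>Identifies the position used in \<open>jac\<close> with the rank that
  \<open>pick\<close> inverts, so that \<open>class_vec\<close> and the class matrices use the same
  order.\<close>

lemma cpos_eq_rank:
  assumes "b < m" "cls b = c"
  shows "cpos cls b = card {a \<in> {b. b < m \<and> cls b = c}. a < b}"
proof -
  have "{b'. b' < b \<and> cls b' = cls b} = {a \<in> {b. b < m \<and> cls b = c}. a < b}"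
    using assms by auto
  then show ?thesis by (simp add: cpos_def)
qed

lemma cpos_bij_betw: "bij_betw (cpos cls) {b. b < m \<and> cls b = c} {..<ncls m cls c}"
proof -
  have "bij_betw (\<lambda>b. card {a \<in> {b. b < m \<and> cls b = c}. a < b}) {b. b < m \<and> cls b = c} {..<ncls m cls c}"
    unfolding ncls_def by (rule rank_bij_betw) simp
  then show ?thesis
    by (rule bij_betw_cong[THEN iffD1, rotated]) (use cpos_eq_rank[of _ m cls c] in auto)
qed

lemma cpos_less: "b < m \<Longrightarrow> cls b = c \<Longrightarrow> cpos cls b < ncls m cls c"
  using cpos_bij_betw[of cls m c] by (auto simp: bij_betw_def)

lemma class_vec_cpos:
  assumes "b < m" "cls b = c"
  shows "class_vec m cls c x $ cpos cls b = x b"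
proof -
  have "pick {b. b < m \<and> cls b = c} (cpos cls b) = b"
    using assms cpos_eq_rank[of b m cls c, OF assms] pick_card_in_set[of b "{b. b < m \<and> cls b = c}"] by simp
  then show ?thesis using cpos_less[of b m cls c, OF assms] by (simp add: class_vec_def)
qed

lemma class_vec_surj:
  assumes "u \<in> carrier_vec (ncls m cls c)"
  shows "class_vec m cls c (\<lambda>b. u $ cpos cls b) = u"
proof (rule eq_vecI)
  fix j assume "j < dim_vec u"
  then have "j \<in> {..<ncls m cls c}" using assms by simp
  then obtain b where b: "b < m" "cls b = c" "j = cpos cls b"
    using cpos_bij_betw[of cls m c] unfolding bij_betw_def by auto
  show "class_vec m cls c (\<lambda>b. u $ cpos cls b) $ j = u $ j"
    unfolding b(3) by (rule class_vec_cpos[of b m cls c, OF b(1,2)])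
qed (use assms in \<open>simp add: class_vec_def\<close>)

lemma class_vec_eq_iff:
  "class_vec m cls c x = class_vec m cls c y \<longleftrightarrow> (\<forall>b. b < m \<longrightarrow> cls b = c \<longrightarrow> x b = y b)"
proof
  assume "class_vec m cls c x = class_vec m cls c y"
  then show "\<forall>b. b < m \<longrightarrow> cls b = c \<longrightarrow> x b = y b" using class_vec_cpos by metis
next
  assume eq: "\<forall>b. b < m \<longrightarrow> cls b = c \<longrightarrow> x b = y b"
  have "pick {b. b < m \<and> cls b = c} j \<in> {b. b < m \<and> cls b = c}" if "j < ncls m cls c" for j
    using that unfolding ncls_def by (intro pick_in_set) simp
  then show "class_vec m cls c x = class_vec m cls c y"
    using eq by (auto simp: class_vec_def)
qed

lemma class_vec_zero: "class_vec m cls c (\<lambda>b. 0) = 0\<^sub>v (ncls m cls c)"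
  by (auto simp: class_vec_def)

lemma sum_class_vec:
  "(\<Sum>j<ncls m cls c. g j (class_vec m cls c x $ j)) = (\<Sum>b | b < m \<and> cls b = c. g (cpos cls b) (x b))"
  by (subst sum.reindex_bij_betw[OF cpos_bij_betw, symmetric])
    (auto simp: class_vec_cpos intro!: sum.cong)

lemma class_vec_mult:
  assumes M: "M \<in> carrier_mat (ncls m cls c) (ncls m cls c)"
  shows "class_vec m cls c (class_mult m cls c M x) = M *\<^sub>v class_vec m cls c x"
proof -
  have "class_vec m cls c (class_mult m cls c M x)
      = class_vec m cls c (\<lambda>b. (M *\<^sub>v class_vec m cls c x) $ cpos cls b)"
    unfolding class_vec_eq_iff
  proof (intro allI impI)
    fix b assume b: "b < m" "cls b = c"
    have "(M *\<^sub>v class_vec m cls c x) $ cpos cls b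
        = (\<Sum>j<ncls m cls c. M $$ (cpos cls b, j) * class_vec m cls c x $ j)"
      using M cpos_less[of b m cls c, OF b] by (auto simp: scalar_prod_def class_vec_def lessThan_atLeast0 intro!: sum.cong)
    also have "\<dots> = class_mult m cls c M x b"
      unfolding class_mult_def by (rule sum_class_vec)
    finally show "class_mult m cls c M x b = (M *\<^sub>v class_vec m cls c x) $ cpos cls b" ..
  qed
  also have "\<dots> = M *\<^sub>v class_vec m cls c x" using M by (intro class_vec_surj) auto
  finally show ?thesis .
qed

lemma class_mult_inj:
  assumes M: "M \<in> carrier_mat (ncls m cls c) (ncls m cls c)" "det M \<noteq> 0"
    and z: "\<And>b. b < m \<Longrightarrow> cls b = c \<Longrightarrow> class_mult m cls c M x b = 0"
    and b: "b < m" "cls b = c"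
  shows "x b = 0"
proof -
  have "M *\<^sub>v class_vec m cls c x = 0\<^sub>v (ncls m cls c)"
    using z unfolding class_vec_mult[OF M(1), symmetric] class_vec_zero[symmetric] class_vec_eq_iff by simp
  then have "class_vec m cls c x = 0\<^sub>v (ncls m cls c)"
    using det_0_iff_vec_prod_zero_field[OF M(1)] M(2) class_vec_carrier by blast
  then show ?thesis using b unfolding class_vec_zero[symmetric] class_vec_eq_iff by simp
qed

text \<open>The inverse matrix gives the preimage. Charges and fluxes are constructed in this way
  from prescribed voltages and currents.\<close>

lemma class_mult_surj:
  assumes M: "M \<in> carrier_mat (ncls m cls c) (ncls m cls c)" "det M \<noteq> 0"
  shows "\<exists>x. \<forall>b. b < m \<longrightarrow> cls b = c \<longrightarrow> class_mult m cls c M x b = y b"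
proof -
  let ?N = "ncls m cls c"
  obtain N where N: "N \<in> carrier_mat ?N ?N" "M * N = 1\<^sub>m ?N"
    using det_non_zero_imp_unit[OF M, of "()"] by (auto simp: Units_def ring_mat_simps)
  define x where "x b = (N *\<^sub>v class_vec m cls c y) $ cpos cls b" for b
  have "class_vec m cls c (class_mult m cls c M x) = M *\<^sub>v (N *\<^sub>v class_vec m cls c y)"
    unfolding class_vec_mult[OF M(1)] x_def using N by (subst class_vec_surj) auto
  also have "\<dots> = class_vec m cls c y"
    using N assoc_mult_mat_vec[OF M(1) N(1) class_vec_carrier, symmetric] by simp
  finally show ?thesis unfolding class_vec_eq_iff by blast
qed

lemma class_mult_zero_mat:
  assumes "b < m" "cls b = c"
  shows "class_mult m cls c (0\<^sub>m (ncls m cls c) (ncls m cls c)) x b = 0"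
  unfolding class_mult_def using assms cpos_less by (intro sum.neutral) auto

lemma class_mult_zero_vec:
  assumes "\<And>b. b < m \<Longrightarrow> cls b = c \<Longrightarrow> x b = 0"
  shows "class_mult m cls c M x b = 0"
  unfolding class_mult_def using assms by (intro sum.neutral) auto

lemma class_quadratic_form:
  assumes M: "M \<in> carrier_mat (ncls m cls c) (ncls m cls c)"
  shows "(\<Sum>b | b < m \<and> cls b = c. x b * class_mult m cls c M x b)
    = class_vec m cls c x \<bullet> (M *\<^sub>v class_vec m cls c x)"
proof -
  have "(\<Sum>b | b < m \<and> cls b = c. x b * class_mult m cls c M x b)
      = (\<Sum>b | b < m \<and> cls b = c. class_vec m cls c (class_mult m cls c M x) $ cpos cls b * x b)"
    by (intro sum.cong) (auto simp: class_vec_cpos)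
  also have "\<dots> = (\<Sum>j<ncls m cls c. class_vec m cls c (class_mult m cls c M x) $ j * class_vec m cls c x $ j)"
    by (rule sum_class_vec[symmetric])
  also have "\<dots> = class_vec m cls c x \<bullet> class_vec m cls c (class_mult m cls c M x)"
    by (auto simp: scalar_prod_def lessThan_atLeast0 class_vec_def intro!: sum.cong)
  finally show ?thesis unfolding class_vec_mult[OF M] .
qed

text \<open>In terms of \<open>class_vec\<close> the sum is the quadratic form of \<open>M\<close>,
  which is positive unless the vector is zero.\<close>

lemma class_quadratic_form_nonneg:
  assumes M: "M \<in> carrier_mat (ncls m cls c) (ncls m cls c)" "pos_def_mat M"
  shows "(\<Sum>b | b < m \<and> cls b = c. x b * class_mult m cls c M x b) \<ge> 0"
    and "(\<Sum>b | b < m \<and> cls b = c. x b * class_mult m cls c M x b) = 0 \<Longrightarrow>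
      b < m \<Longrightarrow> cls b = c \<Longrightarrow> x b = 0"
proof -
  let ?u = "class_vec m cls c x"
  have pos: "?u \<bullet> (M *\<^sub>v ?u) > 0" if "?u \<noteq> 0\<^sub>v (ncls m cls c)"
    using M that class_vec_carrier unfolding pos_def_mat_def by auto
  show "(\<Sum>b | b < m \<and> cls b = c. x b * class_mult m cls c M x b) \<ge> 0"
    unfolding class_quadratic_form[OF M(1)] using pos M(1)
    by (cases "?u = 0\<^sub>v (ncls m cls c)") (auto simp: less_imp_le)
  assume "(\<Sum>b | b < m \<and> cls b = c. x b * class_mult m cls c M x b) = 0" and b: "b < m" "cls b = c"
  then have "?u = 0\<^sub>v (ncls m cls c)"
    unfolding class_quadratic_form[OF M(1)] using pos by fastforce
  then show "x b = 0" using b unfolding class_vec_zero[symmetric] class_vec_eq_iff by simp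
qed

section \<open>State vectors and the rows of the Jacobian\<close>

text \<open>Packs charges and fluxes \<open>x\<close>, voltages \<open>v\<close> and currents
  \<open>i\<close> in the column order of \<open>jac\<close>. All three are functions of the branch;
  \<open>x\<close> is recorded only on the branches with a differential variable.\<close>

definition state_vec :: "nat \<Rightarrow> (nat \<Rightarrow> dev) \<Rightarrow> (nat \<Rightarrow> real) \<Rightarrow> (nat \<Rightarrow> real) \<Rightarrow> (nat \<Rightarrow> real) \<Rightarrow> real vec" where
  "state_vec m cls x v i = (let ds = dyn_branches m cls; p = length ds in
     vec (p + 2 * m) (\<lambda>c. if c < p then x (ds ! c) else if c < p + m then v (c - p) else i (c - p - m)))"

definition dyn_index :: "nat \<Rightarrow> (nat \<Rightarrow> dev) \<Rightarrow> nat \<Rightarrow> nat" where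
  "dyn_index m cls = inv_into {..<length (dyn_branches m cls)} ((!) (dyn_branches m cls))"

lemma dyn_branches_bij_betw:
  "bij_betw ((!) (dyn_branches m cls)) {..<length (dyn_branches m cls)}
     (branches_of m cls {QMem, Cap, PhiMem, Ind})"
  by (rule bij_betw_nth) (auto simp: dyn_branches_def branches_of_def)

lemma dyn_index:
  assumes "b \<in> branches_of m cls {QMem, Cap, PhiMem, Ind}"
  shows "dyn_index m cls b < length (dyn_branches m cls)"
    and "dyn_branches m cls ! dyn_index m cls b = b"
proof -
  have "b \<in> (!) (dyn_branches m cls) ` {..<length (dyn_branches m cls)}"
    using dyn_branches_bij_betw[of m cls] assms unfolding bij_betw_def by simp
  from inv_into_into[OF this] f_inv_into_f[OF this]
  show "dyn_index m cls b < length (dyn_branches m cls)"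
    and "dyn_branches m cls ! dyn_index m cls b = b" by (auto simp: dyn_index_def)
qed

lemma dyn_index_nth:
  assumes "j < length (dyn_branches m cls)"
  shows "dyn_index m cls (dyn_branches m cls ! j) = j"
  unfolding dyn_index_def using dyn_branches_bij_betw[of m cls] assms
  by (intro inv_into_f_f) (auto simp: bij_betw_def)

lemma state_vec_exhaust:
  assumes z: "z \<in> carrier_vec (length (dyn_branches m cls) + 2 * m)"
  obtains x v i where "z = state_vec m cls x v i"
proof
  let ?p = "length (dyn_branches m cls)"
  show "z = state_vec m cls (\<lambda>b. z $ dyn_index m cls b) (\<lambda>b. z $ (?p + b)) (\<lambda>b. z $ (?p + m + b))"
    using z by (intro eq_vecI) (auto simp: state_vec_def Let_def dyn_index_nth)
qed

lemma state_vec_index: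
  shows "b \<in> branches_of m cls {QMem, Cap, PhiMem, Ind} \<Longrightarrow>
      state_vec m cls x v i $ dyn_index m cls b = x b"
    and "b < m \<Longrightarrow> state_vec m cls x v i $ (length (dyn_branches m cls) + b) = v b"
    and "b < m \<Longrightarrow> state_vec m cls x v i $ (length (dyn_branches m cls) + m + b) = i b"
  using dyn_index[of b m cls] by (auto simp: state_vec_def Let_def)

lemma sum_three_blocks:
  fixes g :: "nat \<Rightarrow> real"
  shows "(\<Sum>c<p + 2 * m. g c) = (\<Sum>c<p. g c) + (\<Sum>b<m. g (p + b)) + (\<Sum>b<m. g (p + m + b))"
proof -
  have split: "(\<Sum>c<a + k. g c) = (\<Sum>c<a. g c) + (\<Sum>c<k. g (a + c))" for a k
    by (induction k) (auto simp: algebra_simps)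
  have "p + 2 * m = (p + m) + m" by simp
  then show ?thesis using split[of "p + m" m] split[of p m] by metis
qed

text \<open>The block entries vanish outside class \<open>c\<close>, so any index set containing the
  class yields the same product. It serves both the columns of the differential variables and those
  of all branches.\<close>

lemma sum_class_block:
  assumes "{b. b < m \<and> cls b = c} \<subseteq> K" "finite K" "K \<subseteq> {..<m}"
  shows "(\<Sum>b'\<in>K. (if cls b = c \<and> cls b' = c then M $$ (cpos cls b, cpos cls b') else 0) * x b')
    = (if cls b = c then class_mult m cls c M x b else 0)"
proof -
  have "{b' \<in> K. cls b' = c} = {b. b < m \<and> cls b = c}" using assms by auto
  then show ?thesis using assms(2)
    by (auto simp: class_mult_def if_distrib[of "\<lambda>y. y * _"] sum.inter_filter[symmetric] cong: if_cong)
qed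

text \<open>Within each of the three column blocks, the entry depends on the column only through its
  branch, so a row times a state vector splits into three sums over branches.\<close>

lemma sum_jac_row:
  assumes "\<And>c. c < p + 2 * m \<Longrightarrow> J c = (if c < p then g1 (ds ! c) else if c < p + m then g2 (c - p) else g3 (c - p - m))"
    and "ds = dyn_branches m cls" "p = length ds"
  shows "(\<Sum>c<p + 2 * m. J c * state_vec m cls x v i $ c)
    = (\<Sum>b\<in>branches_of m cls {QMem, Cap, PhiMem, Ind}. g1 b * x b) + (\<Sum>b<m. g2 b * v b) + (\<Sum>b<m. g3 b * (i b :: real))"
proof -
  have "(\<Sum>c<p. J c * state_vec m cls x v i $ c) = (\<Sum>c<p. g1 (ds ! c) * x (ds ! c))"
    using assms by (intro sum.cong) (auto simp: state_vec_def Let_def)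
  also have "\<dots> = (\<Sum>b\<in>branches_of m cls {QMem, Cap, PhiMem, Ind}. g1 b * x b)"
    unfolding assms(2,3) by (rule sum.reindex_bij_betw[OF dyn_branches_bij_betw])
  finally have "(\<Sum>c<p. J c * state_vec m cls x v i $ c) = \<dots>" .
  moreover have "(\<Sum>b<m. J (p + b) * state_vec m cls x v i $ (p + b)) = (\<Sum>b<m. g2 b * v b)"
    using assms by (intro sum.cong) (auto simp: state_vec_def Let_def)
  moreover have "(\<Sum>b<m. J (p + m + b) * state_vec m cls x v i $ (p + m + b)) = (\<Sum>b<m. g3 b * i b)"
    using assms by (intro sum.cong) (auto simp: state_vec_def Let_def)
  ultimately show ?thesis by (simp add: sum_three_blocks)
qed

text \<open>The linearized equations of one branch: its device row, together with its differential
  row if it has one. The latter reads \<open>i b = 0\<close> for a charge and \<open>v b = 0\<close>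
  for a flux.\<close>

definition device_eq :: "nat \<Rightarrow> (nat \<Rightarrow> dev) \<Rightarrow> real mat \<Rightarrow> real mat \<Rightarrow> real mat \<Rightarrow> real mat \<Rightarrow>
    real mat \<Rightarrow> real mat \<Rightarrow> real mat \<Rightarrow> real mat \<Rightarrow>
    (nat \<Rightarrow> real) \<Rightarrow> (nat \<Rightarrow> real) \<Rightarrow> (nat \<Rightarrow> real) \<Rightarrow> nat \<Rightarrow> bool" where
  "device_eq m cls Em Mq Ec R Rw Mw Rl G x v i b \<longleftrightarrow> (case cls b of
      QMem \<Rightarrow> i b = 0 \<and> v b = class_mult m cls QMem Em x b + class_mult m cls QMem Mq i b
    | Cap \<Rightarrow> i b = 0 \<and> v b = class_mult m cls Cap Ec x b
    | CRes \<Rightarrow> v b = class_mult m cls CRes R i b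
    | VSrc \<Rightarrow> v b = 0
    | PhiMem \<Rightarrow> v b = 0 \<and> i b = class_mult m cls PhiMem Rw x b + class_mult m cls PhiMem Mw v b
    | Ind \<Rightarrow> v b = 0 \<and> i b = class_mult m cls Ind Rl x b
    | VRes \<Rightarrow> i b = class_mult m cls VRes G v b
    | ISrc \<Rightarrow> i b = 0)"

lemma jac_carrier:
  "jac m cls B D Em Mq Ec R Rw Mw Rl G \<in>
    carrier_mat (length (dyn_branches m cls) + m + dim_row B + dim_row D) (length (dyn_branches m cls) + 2 * m)"
  by (simp add: jac_def Let_def)

lemma state_vec_carrier: "state_vec m cls x v i \<in> carrier_vec (length (dyn_branches m cls) + 2 * m)"
  by (simp add: state_vec_def Let_def)

lemma jac_mult_state_vec:
  fixes m cls B D Em Mq Ec R Rw Mw Rl G x v i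
  defines "p \<equiv> length (dyn_branches m cls)"
    and "y \<equiv> jac m cls B D Em Mq Ec R Rw Mw Rl G *\<^sub>v state_vec m cls x v i"
  shows "b \<in> branches_of m cls {QMem, Cap, PhiMem, Ind} \<Longrightarrow>
      y $ dyn_index m cls b = (if qdev (cls b) then i b else v b)"
    and "b < m \<Longrightarrow> y $ (p + b) = (if qdev (cls b) then
      v b - (if cls b = QMem then class_mult m cls QMem Em x b else 0)
          - (if cls b = Cap then class_mult m cls Cap Ec x b else 0)
          - (if cls b = QMem then class_mult m cls QMem Mq i b else 0)
          - (if cls b = CRes then class_mult m cls CRes R i b else 0)
      else
      i b - (if cls b = PhiMem then class_mult m cls PhiMem Rw x b else 0)
          - (if cls b = Ind then class_mult m cls Ind Rl x b else 0)
          - (if cls b = PhiMem then class_mult m cls PhiMem Mw v b else 0)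
          - (if cls b = VRes then class_mult m cls VRes G v b else 0))"
    and "r < dim_row B \<Longrightarrow> y $ (p + m + r) = (\<Sum>b<m. B $$ (r, b) * v b)"
    and "s < dim_row D \<Longrightarrow> y $ (p + m + dim_row B + s) = (\<Sum>b<m. D $$ (s, b) * i b)"
proof -
  let ?J = "jac m cls B D Em Mq Ec R Rw Mw Rl G" and ?ds = "dyn_branches m cls"
  let ?K = "branches_of m cls {QMem, Cap, PhiMem, Ind}"
  have y: "y $ row = (\<Sum>c<p + 2 * m. ?J $$ (row, c) * state_vec m cls x v i $ c)"
    if "row < p + m + dim_row B + dim_row D" for row
    using that jac_carrier[of m cls B D Em Mq Ec R Rw Mw Rl G] state_vec_carrier[of m cls x v i]
    unfolding y_def p_def by (auto simp: scalar_prod_def lessThan_atLeast0 intro!: sum.cong)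
  note row = sum_jac_row[OF _ refl p_def[THEN meta_eq_to_obj_eq]]
  have K: "finite ?K" "?K \<subseteq> {..<m}"
    "c \<in> {QMem, Cap, PhiMem, Ind} \<Longrightarrow> {b. b < m \<and> cls b = c} \<subseteq> ?K" for c
    by (auto simp: branches_of_def)
  have full: "{b. b < m \<and> cls b = c} \<subseteq> {..<m}" for c by auto
  note blockK = sum_class_block[OF K(3) K(1,2)]
  note blockm = sum_class_block[OF full finite_lessThan order_refl]
  show "y $ dyn_index m cls b = (if qdev (cls b) then i b else v b)" if b: "b \<in> ?K"
  proof -
    have j: "dyn_index m cls b < p" "?ds ! dyn_index m cls b = b" using dyn_index[OF b] by (auto simp: p_def)
    have bm: "b < m" using b by (simp add: branches_of_def)
    have "y $ dyn_index m cls b = (\<Sum>b'\<in>?K. 0 * x b')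
        + (\<Sum>b'<m. (if \<not> qdev (cls b) \<and> b' = b then 1 else 0) * v b')
        + (\<Sum>b'<m. (if qdev (cls b) \<and> b' = b then 1 else 0) * i b')"
      using j bm by (subst y, simp, intro row) (auto simp: jac_def Let_def p_def)
    also have "\<dots> = (if qdev (cls b) then i b else v b)"
      using bm by (auto simp: if_distrib[of "\<lambda>y. y * _"] cong: if_cong)
    finally show ?thesis .
  qed
  show "y $ (p + b) = (if qdev (cls b) then
      v b - (if cls b = QMem then class_mult m cls QMem Em x b else 0)
          - (if cls b = Cap then class_mult m cls Cap Ec x b else 0)
          - (if cls b = QMem then class_mult m cls QMem Mq i b else 0)
          - (if cls b = CRes then class_mult m cls CRes R i b else 0)
      else
      i b - (if cls b = PhiMem then class_mult m cls PhiMem Rw x b else 0)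
          - (if cls b = Ind then class_mult m cls Ind Rl x b else 0)
          - (if cls b = PhiMem then class_mult m cls PhiMem Mw v b else 0)
          - (if cls b = VRes then class_mult m cls VRes G v b else 0))" if bm: "b < m"
  proof -
    define blk where "blk c M b' = (if cls b = c \<and> cls b' = c then M $$ (cpos cls b, cpos cls b') else 0)"
      for c and M :: "real mat" and b'
    \<comment> \<open>\<open>eK\<close> evaluates the columns of the differential variables,
      \<open>em\<close> a full block of voltage or current columns, and \<open>delta\<close> the
      identity block of the device row.\<close>
    have eK: "(\<Sum>b'\<in>?K. - (blk c M b' + blk c' M' b') * w b')
      = - (if cls b = c then class_mult m cls c M w b else 0) - (if cls b = c' then class_mult m cls c' M' w b else 0)"
      if "c \<in> {QMem, Cap, PhiMem, Ind}" "c' \<in> {QMem, Cap, PhiMem, Ind}" for c c' M M' w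
      using blockK[OF that(1), where b = b and M = M and x = w] blockK[OF that(2), where b = b and M = M' and x = w]
      by (simp add: blk_def[symmetric] algebra_simps sum.distrib sum_subtractf sum_negf)
    have em: "(\<Sum>b'<m. - (blk c M b' + blk c' M' b') * w b')
      = - (if cls b = c then class_mult m cls c M w b else 0) - (if cls b = c' then class_mult m cls c' M' w b else 0)"
      for c c' M M' w
      using blockm[where c = c and b = b and M = M and x = w] blockm[where c = c' and b = b and M = M' and x = w]
      by (simp add: blk_def[symmetric] algebra_simps sum.distrib sum_subtractf sum_negf)
    have delta: "(\<Sum>b'<m. (if b' = b then 1 else 0) * w b') = w b" for w :: "nat \<Rightarrow> real"
      using bm by (simp add: if_distrib[of "\<lambda>y. y * _"] cong: if_cong)
    show ?thesis
    proof (cases "qdev (cls b)")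
      case True
      have "y $ (p + b) = (\<Sum>b'\<in>?K. - (blk QMem Em b' + blk Cap Ec b') * x b')
        + (\<Sum>b'<m. (if b' = b then 1 else 0) * v b')
        + (\<Sum>b'<m. - (blk QMem Mq b' + blk CRes R b') * i b')"
        using bm True by (subst y, simp, intro row) (auto simp: jac_def Let_def p_def blk_def)
      then show ?thesis using True by (simp only: eK em delta insert_iff simp_thms if_True)
    next
      case False
      have "y $ (p + b) = (\<Sum>b'\<in>?K. - (blk PhiMem Rw b' + blk Ind Rl b') * x b')
        + (\<Sum>b'<m. - (blk PhiMem Mw b' + blk VRes G b') * v b')
        + (\<Sum>b'<m. (if b' = b then 1 else 0) * i b')"
        using bm False by (subst y, simp, intro row) (auto simp: jac_def Let_def p_def blk_def)
      then show ?thesis using False by (simp only: eK em delta insert_iff simp_thms if_False)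
    qed
  qed
  show "y $ (p + m + r) = (\<Sum>b<m. B $$ (r, b) * v b)" if r: "r < dim_row B"
  proof -
    have "y $ (p + m + r) = (\<Sum>b'\<in>?K. 0 * x b') + (\<Sum>b<m. B $$ (r, b) * v b) + (\<Sum>b<m. 0 * i b)"
      using r by (subst y, simp, intro row) (auto simp: jac_def Let_def p_def)
    then show ?thesis by simp
  qed
  show "y $ (p + m + dim_row B + s) = (\<Sum>b<m. D $$ (s, b) * i b)" if s: "s < dim_row D"
  proof -
    have "y $ (p + m + dim_row B + s) = (\<Sum>b'\<in>?K. 0 * x b') + (\<Sum>b<m. 0 * v b) + (\<Sum>b<m. D $$ (s, b) * i b)"
      using s by (subst y, simp, intro row) (auto simp: jac_def Let_def p_def)
    then show ?thesis by simp
  qed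
qed

lemma state_vec_mem_kernel_jac:
  "state_vec m cls x v i \<in> mat_kernel (jac m cls B D Em Mq Ec R Rw Mw Rl G) \<longleftrightarrow>
    (\<forall>b<m. device_eq m cls Em Mq Ec R Rw Mw Rl G x v i b) \<and>
    (\<forall>r<dim_row B. (\<Sum>b<m. B $$ (r, b) * v b) = 0) \<and>
    (\<forall>s<dim_row D. (\<Sum>b<m. D $$ (s, b) * i b) = 0)"
proof -
  let ?J = "jac m cls B D Em Mq Ec R Rw Mw Rl G" and ?ds = "dyn_branches m cls"
  let ?K = "branches_of m cls {QMem, Cap, PhiMem, Ind}"
  define p where "p = length ?ds"
  define y where "y = ?J *\<^sub>v state_vec m cls x v i"
  note yi = jac_mult_state_vec[where m = m and cls = cls and B = B and D = D and x = x and v = v and i = i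
      and Em = Em and Mq = Mq and Ec = Ec and R = R and Rw = Rw and Mw = Mw and Rl = Rl and G = G,
      folded y_def p_def]
  have "state_vec m cls x v i \<in> mat_kernel ?J \<longleftrightarrow> (\<forall>j < p + m + dim_row B + dim_row D. y $ j = 0)"
    unfolding mat_kernel[OF jac_carrier] y_def p_def
    using state_vec_carrier[of m cls x v i] jac_carrier[of m cls B D Em Mq Ec R Rw Mw Rl G]
    by (auto simp: vec_eq_iff)
  also have "\<dots> \<longleftrightarrow> (\<forall>b\<in>?K. y $ dyn_index m cls b = 0) \<and> (\<forall>b<m. y $ (p + b) = 0) \<and>
      (\<forall>r<dim_row B. y $ (p + m + r) = 0) \<and> (\<forall>s<dim_row D. y $ (p + m + dim_row B + s) = 0)"
      (is "?L \<longleftrightarrow> ?R")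
  proof
    assume ?L then show ?R using dyn_index(1)[of _ m cls] unfolding p_def[symmetric] by fastforce
  next
    assume R: ?R
    show ?L
    proof (intro allI impI)
      fix j assume j: "j < p + m + dim_row B + dim_row D"
      \<comment> \<open>The row index lies in one of the four row blocks of \<open>jac\<close>; rows
        of the first one are named by branches through \<open>dyn_index\<close>.\<close>
      consider "j < p" | b where "j = p + b" "b < m" | r where "j = p + m + r" "r < dim_row B"
        | s where "j = p + m + dim_row B + s" "s < dim_row D"
        using j by (metis add.assoc add_less_cancel_left le_add_diff_inverse not_less)
      then show "y $ j = 0"
      proof cases
        case 1
        then have "?ds ! j \<in> ?K" using dyn_branches_bij_betw[of m cls]
          unfolding p_def bij_betw_def by auto
        then show ?thesis using R dyn_index_nth[of j m cls] 1 unfolding p_def by metis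
      qed (use R in auto)
    qed
  qed
  also have "\<dots> \<longleftrightarrow> (\<forall>b<m. device_eq m cls Em Mq Ec R Rw Mw Rl G x v i b) \<and>
    (\<forall>r<dim_row B. (\<Sum>b<m. B $$ (r, b) * v b) = 0) \<and>
    (\<forall>s<dim_row D. (\<Sum>b<m. D $$ (s, b) * i b) = 0)"
  proof -
    have "(\<forall>b\<in>?K. y $ dyn_index m cls b = 0) \<and> (\<forall>b<m. y $ (p + b) = 0) \<longleftrightarrow>
      (\<forall>b<m. (b \<in> ?K \<longrightarrow> y $ dyn_index m cls b = 0) \<and> y $ (p + b) = 0)"
      by (auto simp: branches_of_def)
    also have "\<dots> \<longleftrightarrow> (\<forall>b<m. device_eq m cls Em Mq Ec R Rw Mw Rl G x v i b)"
    proof (intro all_cong)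
      fix b assume b: "b < m"
      show "(b \<in> ?K \<longrightarrow> y $ dyn_index m cls b = 0) \<and> y $ (p + b) = 0 \<longleftrightarrow>
        device_eq m cls Em Mq Ec R Rw Mw Rl G x v i b"
        using yi(1)[of b] yi(2)[OF b] b
        by (cases "cls b") (auto simp: branches_of_def device_eq_def qdev_def)
    qed
    finally show ?thesis using yi(3,4) by auto
  qed
  finally show ?thesis .
qed

section \<open>Support of kernel vectors and the dimension count\<close>

text \<open>The rows of \<open>B\<close> span all loop vectors and those of \<open>D\<close> all
  cutset vectors, so orthogonality to the rows is enough for Tellegen's theorem.\<close>

lemma tellegen_reduced:
  assumes graph: "digraph_ok n m src dst"
    and B: "reduced_loop_matrix n m src dst B" and D: "reduced_cutset_matrix n m src dst D"
    and v: "\<And>r. r < dim_row B \<Longrightarrow> (\<Sum>b<m. B $$ (r, b) * v b) = 0"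
    and i: "\<And>s. s < dim_row D \<Longrightarrow> (\<Sum>b<m. D $$ (s, b) * i b) = 0"
  shows "(\<Sum>b<m. v b * i b) = 0"
proof -
  have orth: "(\<Sum>b<m. x $ b * w b) = 0"
    if M: "dim_col M = m" "\<And>r. r < dim_row M \<Longrightarrow> (\<Sum>b<m. M $$ (r, b) * w b) = 0"
      and y: "y \<in> carrier_vec (dim_row M)" "x = transpose_mat M *\<^sub>v y" for M :: "real mat" and w x y
  proof -
    have "(\<Sum>b<m. x $ b * w b) = (\<Sum>b<m. \<Sum>r<dim_row M. y $ r * (M $$ (r, b) * w b))"
      using M(1) y by (auto simp: scalar_prod_def lessThan_atLeast0 sum_distrib_left ac_simps intro!: sum.cong)
    also have "\<dots> = (\<Sum>r<dim_row M. y $ r * (\<Sum>b<m. M $$ (r, b) * w b))"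
      by (subst sum.swap) (simp add: sum_distrib_left)
    also have "\<dots> = 0" using M(2) by (intro sum.neutral) auto
    finally show ?thesis .
  qed
  show ?thesis
  proof (rule tellegen[OF graph])
    fix x assume "loop_vec n m src dst x"
    then show "(\<Sum>b<m. x $ b * v b) = 0"
      using B orth[of B v] v unfolding reduced_loop_matrix_def by blast
  next
    fix x assume "cutset_vec n m src dst x"
    then show "(\<Sum>b<m. x $ b * i b) = 0"
      using D orth[of D i] i unfolding reduced_cutset_matrix_def by blast
  qed
qed

lemma sum_supported:
  fixes g w :: "nat \<Rightarrow> real"
  assumes "K \<subseteq> {..<m}" "\<And>b. b < m \<Longrightarrow> b \<notin> K \<Longrightarrow> w b = 0"
  shows "(\<Sum>b<m. g b * w b) = (\<Sum>b\<in>K. g b * w b)"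
  using assms by (intro sum.mono_neutral_right) auto

text \<open>Loops inside a branch set are counted by the kernel of the corresponding columns of
  \<open>D\<close>, cutsets by that of the columns of \<open>B\<close>. Hence \<open>D\<close> is
  restricted to voltage sources and inductors and \<open>B\<close> to current sources and
  capacitors.\<close>

theorem theorem3:
  fixes n m :: nat and src dst :: "nat \<Rightarrow> nat" and cls :: "nat \<Rightarrow> dev"
    and B D Em Mq Ec R Rw Mw Rl G :: "real mat"
  assumes graph: "digraph_ok n m src dst"
    and B: "reduced_loop_matrix n m src dst B"
    and D: "reduced_cutset_matrix n m src dst D"
    and Em: "Em = 0\<^sub>m (ncls m cls QMem) (ncls m cls QMem)"
    and Mq: "Mq \<in> carrier_mat (ncls m cls QMem) (ncls m cls QMem)"
    and Ec: "Ec \<in> carrier_mat (ncls m cls Cap) (ncls m cls Cap)" "det Ec \<noteq> 0"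
    and R: "R \<in> carrier_mat (ncls m cls CRes) (ncls m cls CRes)" "pos_def_mat R"
    and Rw: "Rw = 0\<^sub>m (ncls m cls PhiMem) (ncls m cls PhiMem)"
    and Mw: "Mw \<in> carrier_mat (ncls m cls PhiMem) (ncls m cls PhiMem)"
    and Rl: "Rl \<in> carrier_mat (ncls m cls Ind) (ncls m cls Ind)" "det Rl \<noteq> 0"
    and G: "G \<in> carrier_mat (ncls m cls VRes) (ncls m cls VRes)" "pos_def_mat G"
  shows "kernel_dim (jac m cls B D Em Mq Ec R Rw Mw Rl G) =
           ncls m cls QMem + ncls m cls PhiMem
           + kernel_dim (submatrix D {..<dim_row D} (branches_of m cls {VSrc, Ind}))
           + kernel_dim (submatrix B {..<dim_row B} (branches_of m cls {ISrc, Cap}))"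
proof -
  let ?J = "jac m cls B D Em Mq Ec R Rw Mw Rl G"
  define p where "p = length (dyn_branches m cls)"
  define nc where "nc = p + 2 * m"
  define Mem where "Mem = branches_of m cls {QMem, PhiMem}"
  define VL where "VL = branches_of m cls {VSrc, Ind}"
  define IC where "IC = branches_of m cls {ISrc, Cap}"
  \<comment> \<open>The three coordinates on the kernel: charges and fluxes of memristors, currents
    of voltage sources and inductors, voltages of current sources and capacitors.\<close>
  define P0 :: "real mat" where "P0 = coord_mat (card Mem) nc (\<lambda>j. dyn_index m cls (pick Mem j))"
  define P1 :: "real mat" where "P1 = coord_mat (card VL) nc (\<lambda>j. p + m + pick VL j)"
  define P2 :: "real mat" where "P2 = coord_mat (card IC) nc (\<lambda>j. p + pick IC j)"
  note state_kernel = state_vec_mem_kernel_jac[of m cls _ _ _ B D Em Mq Ec R Rw Mw Rl G]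

  have cols: "dim_col B = m" "dim_col D = m"
    using B D by (auto simp: reduced_loop_matrix_def reduced_cutset_matrix_def)
  have sub: "VL \<subseteq> {..<m}" "IC \<subseteq> {..<m}"
    and sub': "VL \<subseteq> {..<dim_col D}" "IC \<subseteq> {..<dim_col B}"
    by (auto simp: VL_def IC_def branches_of_def cols)
  have fin: "finite Mem" by (auto simp: Mem_def branches_of_def)
  have pick: "j < card Mem \<Longrightarrow> pick Mem j \<in> Mem" "j < card VL \<Longrightarrow> pick VL j \<in> VL"
    "j < card IC \<Longrightarrow> pick IC j \<in> IC" for j by (simp_all add: pick_in_set)
  have Mem_dyn: "Mem \<subseteq> branches_of m cls {QMem, Cap, PhiMem, Ind}"
    by (auto simp: Mem_def branches_of_def)

  have proj:
    "P0 *\<^sub>v state_vec m cls x v i = vec (card Mem) (\<lambda>j. x (pick Mem j))"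
    "P1 *\<^sub>v state_vec m cls x v i = vec (card VL) (\<lambda>j. i (pick VL j))"
    "P2 *\<^sub>v state_vec m cls x v i = vec (card IC) (\<lambda>j. v (pick IC j))" for x v i
  proof -
    let ?z = "state_vec m cls x v i"
    have z: "?z \<in> carrier_vec nc" unfolding nc_def p_def by (rule state_vec_carrier)
    have "dyn_index m cls (pick Mem j) < nc" if "j < card Mem" for j
      using dyn_index(1)[of "pick Mem j" m cls] pick(1)[OF that] Mem_dyn
      unfolding nc_def p_def by fastforce
    then show "P0 *\<^sub>v ?z = vec (card Mem) (\<lambda>j. x (pick Mem j))"
      unfolding P0_def using pick(1) Mem_dyn
      by (subst coord_mat_mult[OF z]) (auto simp: state_vec_index(1) subset_iff)
    have VLm: "pick VL j < m" if "j < card VL" for j using pick(2)[OF that] sub(1) by auto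
    then show "P1 *\<^sub>v ?z = vec (card VL) (\<lambda>j. i (pick VL j))"
      unfolding P1_def
      by (subst coord_mat_mult[OF z]) (auto simp: nc_def p_def state_vec_index(3))
    have ICm: "pick IC j < m" if "j < card IC" for j using pick(3)[OF that] sub(2) by auto
    then show "P2 *\<^sub>v ?z = vec (card IC) (\<lambda>j. v (pick IC j))"
      unfolding P2_def
      by (subst coord_mat_mult[OF z]) (fastforce simp: nc_def p_def state_vec_index(2))+
  qed

  have kernel: "(\<forall>b<m. b \<notin> IC \<longrightarrow> v b = 0) \<and> (\<forall>b<m. b \<notin> VL \<longrightarrow> i b = 0)"
    if z: "state_vec m cls x v i \<in> mat_kernel ?J" for x v i
  proof -
    have dev: "\<And>b. b < m \<Longrightarrow> device_eq m cls Em Mq Ec R Rw Mw Rl G x v i b"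
      and Bv: "\<And>r. r < dim_row B \<Longrightarrow> (\<Sum>b<m. B $$ (r, b) * v b) = 0"
      and Di: "\<And>s. s < dim_row D \<Longrightarrow> (\<Sum>b<m. D $$ (s, b) * i b) = 0"
      using z unfolding state_kernel by auto
    \<comment> \<open>The differential rows kill the currents of the whole class, so
      \<open>Mq\<close> contributes nothing; \<open>Em\<close> is zero, and the voltage vanishes as
      well. The flux case \<open>pm\<close> is dual.\<close>
    have qm: "i b = 0 \<and> v b = 0" if b: "b < m" "cls b = QMem" for b
    proof -
      have "i b' = 0" if "b' < m" "cls b' = QMem" for b' using dev[OF that(1)] that by (simp add: device_eq_def)
      then show ?thesis using dev[OF b(1)] b class_mult_zero_mat[of b m cls QMem x] class_mult_zero_vec[of m cls QMem i Mq b]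
        by (simp add: device_eq_def Em)
    qed
    have pm: "i b = 0 \<and> v b = 0" if b: "b < m" "cls b = PhiMem" for b
    proof -
      have "v b' = 0" if "b' < m" "cls b' = PhiMem" for b' using dev[OF that(1)] that by (simp add: device_eq_def)
      then show ?thesis using dev[OF b(1)] b class_mult_zero_mat[of b m cls PhiMem x] class_mult_zero_vec[of m cls PhiMem v Mw b]
        by (simp add: device_eq_def Rw)
    qed
    \<comment> \<open>Outside the two resistor classes either \<open>v b\<close> or
      \<open>i b\<close> is zero.\<close>
    have prod: "v b * i b = (if cls b = CRes then i b * class_mult m cls CRes R i b else 0)
        + (if cls b = VRes then v b * class_mult m cls VRes G v b else 0)" if b: "b < m" for b
      using dev[OF b] qm[OF b] pm[OF b] by (cases "cls b") (auto simp: device_eq_def)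
    let ?qR = "\<Sum>b | b < m \<and> cls b = CRes. i b * class_mult m cls CRes R i b"
    let ?qG = "\<Sum>b | b < m \<and> cls b = VRes. v b * class_mult m cls VRes G v b"
    have "0 = (\<Sum>b<m. v b * i b)"
      using tellegen_reduced[OF graph B D, of v i] Bv Di by simp
    also have "\<dots> = (\<Sum>b<m. if cls b = CRes then i b * class_mult m cls CRes R i b else 0)
        + (\<Sum>b<m. if cls b = VRes then v b * class_mult m cls VRes G v b else 0)"
      using prod by (simp add: sum.distrib)
    also have "\<dots> = ?qR + ?qG"
      by (simp add: sum.inter_filter[symmetric])
    finally have "?qR + ?qG = 0" by simp
    \<comment> \<open>Two nonnegative quadratic forms with sum zero both vanish.\<close>
    then have q0: "?qR = 0" "?qG = 0"
      using class_quadratic_form_nonneg(1)[OF R, of i] class_quadratic_form_nonneg(1)[OF G, of v] by linarith+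
    have iR: "i b = 0" if "b < m" "cls b = CRes" for b
      by (rule class_quadratic_form_nonneg(2)[OF R q0(1) that])
    have vG: "v b = 0" if "b < m" "cls b = VRes" for b
      by (rule class_quadratic_form_nonneg(2)[OF G q0(2) that])
    have vR: "v b = 0" if "b < m" "cls b = CRes" for b
      using dev[OF that(1)] that class_mult_zero_vec[of m cls CRes i R b] iR by (simp add: device_eq_def)
    have iG: "i b = 0" if "b < m" "cls b = VRes" for b
      using dev[OF that(1)] that class_mult_zero_vec[of m cls VRes v G b] vG by (simp add: device_eq_def)
    show ?thesis
    proof (intro conjI allI impI)
      fix b assume b: "b < m"
      show "v b = 0" if "b \<notin> IC"
        using that b dev[OF b] qm[OF b] pm[OF b] vR[OF b] vG[OF b]
        by (cases "cls b") (auto simp: IC_def branches_of_def device_eq_def)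
      show "i b = 0" if "b \<notin> VL"
        using that b dev[OF b] qm[OF b] pm[OF b] iR[OF b] iG[OF b]
        by (cases "cls b") (auto simp: VL_def branches_of_def device_eq_def)
    qed
  qed

  have "kernel_dim ?J = card Mem + kernel_dim (submatrix D {..<dim_row D} VL)
      + kernel_dim (submatrix B {..<dim_row B} IC)"
  proof (rule kernel_dim_three_summands)
    show "?J \<in> carrier_mat (p + m + dim_row B + dim_row D) nc"
      unfolding p_def nc_def by (rule jac_carrier)
    show "P0 \<in> carrier_mat (card Mem) nc" "P1 \<in> carrier_mat (card VL) nc" "P2 \<in> carrier_mat (card IC) nc"
      by (simp_all add: P0_def P1_def P2_def)
    show "submatrix D {..<dim_row D} VL \<in> carrier_mat (dim_row D) (card VL)"
      "submatrix B {..<dim_row B} IC \<in> carrier_mat (dim_row B) (card IC)"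
      by (rule mat_kernel_submatrix_cols(1)[OF sub'(1)] mat_kernel_submatrix_cols(1)[OF sub'(2)])+
  next
    fix z assume z: "z \<in> mat_kernel ?J"
    then have "z \<in> carrier_vec (length (dyn_branches m cls) + 2 * m)" by (rule mat_kernelD(1)[OF jac_carrier])
    then obtain x v i where s: "z = state_vec m cls x v i" by (rule state_vec_exhaust)
    have supp: "\<And>b. b < m \<Longrightarrow> b \<notin> IC \<Longrightarrow> v b = 0" "\<And>b. b < m \<Longrightarrow> b \<notin> VL \<Longrightarrow> i b = 0"
      and Bv: "\<And>r. r < dim_row B \<Longrightarrow> (\<Sum>b<m. B $$ (r, b) * v b) = 0"
      and Di: "\<And>s. s < dim_row D \<Longrightarrow> (\<Sum>b<m. D $$ (s, b) * i b) = 0"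
      and dev: "\<And>b. b < m \<Longrightarrow> device_eq m cls Em Mq Ec R Rw Mw Rl G x v i b"
      using kernel[OF z[unfolded s]] z[unfolded s state_kernel] by auto
    show "P1 *\<^sub>v z \<in> mat_kernel (submatrix D {..<dim_row D} VL) \<and>
        P2 *\<^sub>v z \<in> mat_kernel (submatrix B {..<dim_row B} IC)"
      unfolding s proj mat_kernel_submatrix_cols(2)[OF sub'(1)] mat_kernel_submatrix_cols(2)[OF sub'(2)]
      using Bv Di sum_supported[of VL m i, OF sub(1) supp(2)] sum_supported[of IC m v, OF sub(2) supp(1)]
      by simp
    assume P: "P0 *\<^sub>v z = 0\<^sub>v (card Mem)" "P1 *\<^sub>v z = 0\<^sub>v (card VL)" "P2 *\<^sub>v z = 0\<^sub>v (card IC)"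
    \<comment> \<open>Translates the vanishing of a projected vector back to branches:
      \<open>b\<close> sits at the position given by its rank in \<open>K\<close>.\<close>
    have restrict0: "w b = 0" if "vec (card K) (\<lambda>j. w (pick K j)) = 0\<^sub>v (card K)" "b \<in> K" "finite K"
      for w :: "nat \<Rightarrow> real" and b K
    proof -
      have "card {a \<in> K. a < b} < card K" using that(2,3) by (intro psubset_card_mono) auto
      then show ?thesis
        using arg_cong[OF that(1), of "\<lambda>y. y $ card {a \<in> K. a < b}"] pick_card_in_set[OF that(2)] by simp
    qed
    have v0: "v b = 0" if "b < m" for b
      using restrict0[OF P(3)[unfolded s proj]] supp(1) that finite_subset[OF sub(2)] by blast
    have i0: "i b = 0" if "b < m" for b
      using restrict0[OF P(2)[unfolded s proj]] supp(2) that finite_subset[OF sub(1)] by blast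
    \<comment> \<open>Once \<open>v\<close> is zero, the capacitor equation says that
      \<open>Ec\<close> annihilates the charges, and \<open>Ec\<close> is non-singular. The inductor
      step \<open>xL\<close> is the same with \<open>Rl\<close> and \<open>i\<close>.\<close>
    have xC: "x b = 0" if "b < m" "cls b = Cap" for b
    proof (rule class_mult_inj[OF Ec _ that])
      fix b assume "b < m" "cls b = Cap"
      then show "class_mult m cls Cap Ec x b = 0" using dev[of b] v0[of b] by (simp add: device_eq_def)
    qed
    have xL: "x b = 0" if "b < m" "cls b = Ind" for b
    proof (rule class_mult_inj[OF Rl _ that])
      fix b assume "b < m" "cls b = Ind"
      then show "class_mult m cls Ind Rl x b = 0" using dev[of b] i0[of b] by (simp add: device_eq_def)
    qed
    have x0: "x b = 0" if b: "b \<in> branches_of m cls {QMem, Cap, PhiMem, Ind}" for b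
    proof (cases "b \<in> Mem")
      case True then show ?thesis using restrict0[OF P(1)[unfolded s proj]] fin by blast
    next
      case False then show ?thesis using b xC[of b] xL[of b] by (auto simp: Mem_def branches_of_def)
    qed
    have "dyn_branches m cls ! c \<in> branches_of m cls {QMem, Cap, PhiMem, Ind}" if "c < p" for c
      using dyn_branches_bij_betw[of m cls] that unfolding p_def bij_betw_def by auto
    then show "z = 0\<^sub>v nc"
      unfolding s using x0 v0 i0
      by (intro eq_vecI) (auto simp: state_vec_def Let_def nc_def p_def)
  next
    fix y0 y1 y2 :: "real vec"
    assume y0: "y0 \<in> carrier_vec (card Mem)"
      and y1: "y1 \<in> mat_kernel (submatrix D {..<dim_row D} VL)"
      and y2: "y2 \<in> mat_kernel (submatrix B {..<dim_row B} IC)"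
    have y1c: "y1 \<in> carrier_vec (card VL)" and y2c: "y2 \<in> carrier_vec (card IC)"
      using mat_kernelD(1)[OF mat_kernel_submatrix_cols(1)[OF sub'(1)] y1]
        mat_kernelD(1)[OF mat_kernel_submatrix_cols(1)[OF sub'(2)] y2] by auto
    \<comment> \<open>The given vectors are extended by zero to all branches, so that the full sums
      over \<open>D\<close> and \<open>B\<close> reduce to the selected columns.\<close>
    define i where "i b = (if b \<in> VL then y1 $ card {a \<in> VL. a < b} else 0)" for b
    define v where "v b = (if b \<in> IC then y2 $ card {a \<in> IC. a < b} else 0)" for b
    have i_y1: "vec (card VL) (\<lambda>j. i (pick VL j)) = y1"
      using y1c pick(2) by (auto simp: i_def card_pick)
    have v_y2: "vec (card IC) (\<lambda>j. v (pick IC j)) = y2"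
      using y2c pick(3) by (auto simp: v_def card_pick)
    obtain xC where xC: "\<And>b. b < m \<Longrightarrow> cls b = Cap \<Longrightarrow> class_mult m cls Cap Ec xC b = v b"
      using class_mult_surj[OF Ec] by blast
    obtain xL where xL: "\<And>b. b < m \<Longrightarrow> cls b = Ind \<Longrightarrow> class_mult m cls Ind Rl xL b = i b"
      using class_mult_surj[OF Rl] by blast
    \<comment> \<open>Capacitors and inductors get the preimages just found, memristors the free
      data \<open>y0\<close>. On branches without a differential variable the value is arbitrary,
      since \<open>state_vec\<close> does not read it.\<close>
    define x where "x b = (if cls b = Cap then xC b else if cls b = Ind then xL b
      else y0 $ card {a \<in> Mem. a < b})" for b
    have cong: "class_mult m cls c M x b = class_mult m cls c M x' b"
      if "\<And>b. cls b = c \<Longrightarrow> x b = x' b" for c M x' b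
      using that unfolding class_mult_def by (intro sum.cong) auto
    have "pick Mem j \<in> Mem \<Longrightarrow> cls (pick Mem j) \<noteq> Cap \<and> cls (pick Mem j) \<noteq> Ind" for j
      by (auto simp: Mem_def branches_of_def)
    then have x_y0: "vec (card Mem) (\<lambda>j. x (pick Mem j)) = y0"
      using y0 pick(1) by (auto simp: x_def card_pick)
    \<comment> \<open>Memristors and resistors carry neither voltage nor current here, so all their
      terms vanish; capacitors and inductors satisfy their equations by the choice of
      \<open>x\<close>.\<close>
    have "device_eq m cls Em Mq Ec R Rw Mw Rl G x v i b" if b: "b < m" for b
    proof -
      have nv: "v b = 0" if "cls b \<notin> {ISrc, Cap}" for b
        using that by (auto simp: v_def IC_def branches_of_def)
      have ni: "i b = 0" if "cls b \<notin> {VSrc, Ind}" for b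
        using that by (auto simp: i_def VL_def branches_of_def)
      have "class_mult m cls Cap Ec x b = v b" if "cls b = Cap"
        using xC[OF b that] cong[of Cap xC Ec b] by (simp add: x_def)
      moreover have "class_mult m cls Ind Rl x b = i b" if "cls b = Ind"
        using xL[OF b that] cong[of Ind xL Rl b] by (simp add: x_def)
      moreover have "class_mult m cls QMem Mq i b = 0" "class_mult m cls CRes R i b = 0"
        "class_mult m cls PhiMem Mw v b = 0" "class_mult m cls VRes G v b = 0"
        using nv ni by (auto intro!: class_mult_zero_vec)
      ultimately show ?thesis
        using b nv[of b] ni[of b] class_mult_zero_mat[of b m cls QMem x] class_mult_zero_mat[of b m cls PhiMem x]
        by (cases "cls b") (auto simp: device_eq_def Em Rw)
    qed
    moreover have "(\<Sum>b<m. B $$ (r, b) * v b) = 0" if "r < dim_row B" for r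
      using y2 that mat_kernel_submatrix_cols(2)[OF sub'(2), of v] sum_supported[of IC m v, OF sub(2)]
      unfolding v_y2 by (simp add: v_def)
    moreover have "(\<Sum>b<m. D $$ (s, b) * i b) = 0" if "s < dim_row D" for s
      using y1 that mat_kernel_submatrix_cols(2)[OF sub'(1), of i] sum_supported[of VL m i, OF sub(1)]
      unfolding i_y1 by (simp add: i_def)
    ultimately have "state_vec m cls x v i \<in> mat_kernel ?J" unfolding state_kernel by blast
    then show "\<exists>z\<in>mat_kernel ?J. P0 *\<^sub>v z = y0 \<and> P1 *\<^sub>v z = y1 \<and> P2 *\<^sub>v z = y2"
      using proj[of x v i] x_y0 i_y1 v_y2 by auto
  qed
  moreover have "card Mem = ncls m cls QMem + ncls m cls PhiMem"
  proof -
    have "Mem = {b. b < m \<and> cls b = QMem} \<union> {b. b < m \<and> cls b = PhiMem}"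
      by (auto simp: Mem_def branches_of_def)
    then show ?thesis unfolding ncls_def by (simp, subst card_Un_disjoint) auto
  qed
  ultimately show ?thesis by (simp add: VL_def IC_def)
qed

end
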